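(* Let $h\geq 2$ and $r\geq 2$ be integers, and let $F_{1},F_{2},\dots,F_{h}$ be vertex-critical graphs with $\chi(F_{i})=r+1\geq 3$ for every $1\leq i\leq h$, such that $F_{1},F_{2},\dots,F_{h}$ is properly ordered. Then, for all sufficiently large $n$, $$\mathrm{ex}\Big(n,\bigcup_{1\leq i\leq h}F_{i}\Big)=\max_{1\leq \ell\leq h}\left\{\binom{\ell-1}{2}+(\ell-1)(n-\ell+1)+\mathrm{ex}(n-\ell+1,F_{\ell})\right\}.$$ Moreover, every graph in $\mathrm{EX}(n,\bigcup_{1\leq i\leq h}F_{i})$ is of the form $K_{\ell-1}\prod H$ for some $1\leq \ell\leq h$, where $H\in \mathrm{EX}(n-\ell+1,F_{\ell})$.
   Context: All graphs are finite, simple and undirected; $\chi(G)$ is the chromatic number. For a graph $F$, a graph $G$ is $F$-free if it contains no subgraph isomorphic to $F$; $\mathrm{EX}(n,F)$ is the set of $F$-free graphs on $n$ vertices with the maximum possible number of edges, and $\mathrm{ex}(n,F)$ is the number of edges of any graph in $\mathrm{EX}(n,F)$. A graph $F$ is vertex-critical if there is a vertex $u$ of $F$ with $\chi(F-u)=\chi(F)-1$. $\bigcup_{1\leq i\leq h}F_{i}$ denotes the vertex-disjoint union of $F_1,\dots,F_h$. For graphs $G_1,G_2$, $G_1\prod G_2$ denotes the join: the disjoint union of $G_1$ and $G_2$ together with all edges between $V(G_1)$ and $V(G_2)$; $K_{0}\prod H$ means $H$. $K_m$ is the complete graph on $m$ vertices, and $\binom{a}{2}=0$ for $a\in\{0,1\}$.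 Graphs $F_{1},\dots,F_{h}$, all with chromatic number $r+1\geq 3$, are called properly ordered if for every (sufficiently large) number of vertices $N$ and every $1\leq \ell\leq h$, there exists at least one graph in $\mathrm{EX}(N,F_{\ell})$ that contains no copy of any $F_{j}$ with $1\leq j\leq \ell$. *)

theory Defs
  imports Complex_Main
begin

text \<open>
  A graph is a vertex set with a set of two-element edges; \<open>simple_graph\<close> is the well-formedness
  condition. The vertices may come from any type.
\<close>

record 'a graph =
  verts :: "'a set"
  edges :: "'a set set"

definition simple_graph :: "'a graph \<Rightarrow> bool" where
  "simple_graph G \<longleftrightarrow> finite (verts G) \<and> (\<forall>e\<in>edges G. e \<subseteq> verts G \<and> card e = 2)"

definition subgraph :: "'a graph \<Rightarrow> 'a graph \<Rightarrow> bool" where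
  "subgraph S G \<longleftrightarrow> simple_graph S \<and> verts S \<subseteq> verts G \<and> edges S \<subseteq> edges G"

definition graph_iso :: "'a graph \<Rightarrow> 'b graph \<Rightarrow> bool" where
  "graph_iso G H \<longleftrightarrow>
     (\<exists>f. bij_betw f (verts G) (verts H) \<and> (\<lambda>e. f ` e) ` edges G = edges H)"

definition graph_free :: "'f graph \<Rightarrow> 'a graph \<Rightarrow> bool" where
  "graph_free F G \<longleftrightarrow> \<not> (\<exists>S. subgraph S G \<and> graph_iso S F)"

definition proper_colouring :: "'a graph \<Rightarrow> nat \<Rightarrow> ('a \<Rightarrow> nat) \<Rightarrow> bool" where
  "proper_colouring G k c \<longleftrightarrow>
     c ` verts G \<subseteq> {..<k} \<and> (\<forall>u v. {u, v} \<in> edges G \<longrightarrow> c u \<noteq> c v)"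

definition chromatic_number :: "'a graph \<Rightarrow> nat" where
  "chromatic_number G = (LEAST k. \<exists>c. proper_colouring G k c)"

definition delete_vertex :: "'a graph \<Rightarrow> 'a \<Rightarrow> 'a graph" where
  "delete_vertex G u = \<lparr>verts = verts G - {u}, edges = {e \<in> edges G. u \<notin> e}\<rparr>"

definition vertex_critical :: "'a graph \<Rightarrow> bool" where
  "vertex_critical F \<longleftrightarrow>
     (\<exists>u\<in>verts F. chromatic_number (delete_vertex F u) = chromatic_number F - 1)"

text \<open>
  Every graph on \<open>n\<close> vertices has an isomorphic copy with natural numbers as vertices, so it
  suffices to maximise over those; this keeps \<open>ex_number\<close> independent of the vertex type of
  the graphs collected in \<open>extremal_graphs\<close>. The maximum is over a finite set, which is nonempty
  as soon as \<open>F\<close> has an edge.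
\<close>

definition ex_number :: "nat \<Rightarrow> 'f graph \<Rightarrow> nat" where
  "ex_number n F =
     Max {card (edges G) | G :: nat graph. simple_graph G \<and> card (verts G) = n \<and> graph_free F G}"

definition extremal_graphs :: "nat \<Rightarrow> 'f graph \<Rightarrow> 'a graph set" where
  "extremal_graphs n F =
     {G. simple_graph G \<and> card (verts G) = n \<and> graph_free F G \<and> card (edges G) = ex_number n F}"

definition disjoint_union :: "'i set \<Rightarrow> ('i \<Rightarrow> 'f graph) \<Rightarrow> ('i \<times> 'f) graph" where
  "disjoint_union I F =
     \<lparr>verts = (SIGMA i:I. verts (F i)), edges = (\<Union>i\<in>I. (\<lambda>e. Pair i ` e) ` edges (F i))\<rparr>"

definition graph_join :: "'a graph \<Rightarrow> 'b graph \<Rightarrow> ('a + 'b) graph" where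
  "graph_join G H =
     \<lparr>verts = verts G <+> verts H,
      edges = (\<lambda>e. Inl ` e) ` edges G \<union> (\<lambda>e. Inr ` e) ` edges H
                \<union> {{Inl u, Inr v} | u v. u \<in> verts G \<and> v \<in> verts H}\<rparr>"

definition complete_graph :: "nat \<Rightarrow> nat graph" where
  "complete_graph m = \<lparr>verts = {..<m}, edges = {e. e \<subseteq> {..<m} \<and> card e = 2}\<rparr>"

definition properly_ordered :: "nat \<Rightarrow> (nat \<Rightarrow> 'f graph) \<Rightarrow> bool" where
  "properly_ordered h F \<longleftrightarrow>
     (\<forall>\<^sub>F N in sequentially. \<forall>l\<in>{1..h}.
        \<exists>G :: nat graph. G \<in> extremal_graphs N (F l) \<and> (\<forall>j\<in>{1..l}. graph_free (F j) G))"

end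

theory Submission
  imports Defs "HOL-Library.FuncSet"
begin

text \<open>
  Let \<open>t\<close> bound the orders of the \<open>F i\<close>. Deleting a critical vertex leaves an \<open>r\<close>-colourable
  graph, so each \<open>F i\<close> embeds into a vertex joined to \<open>K\<^sub>r(t)\<close>. In a dense graph \<open>G\<close> without the
  disjoint union, the neighbourhood of every vertex of degree at least \<open>(1 - 1/r + \<epsilon>)n\<close> contains
  \<open>K\<^sub>r(t)\<close> even after a bounded number of deletions, so such a vertex can host any one of the
  \<open>F i\<close>. Let \<open>W\<close> be the set of these vertices and \<open>s = |W|\<close>; then \<open>s < h\<close>.

  If \<open>G - W\<close> contains \<open>F (s + 1)\<close>, take a maximal subfamily containing \<open>s + 1\<close> that packs
  disjointly into \<open>G - W\<close>. It has fewer than \<open>h - s\<close> members, hence misses some \<open>j \<ge> s + 2\<close>, and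
  deleting the boundedly many vertices it covers leaves an \<open>F j\<close>-free graph. Since
  \<open>ex(N + 1, F j) - ex(N, F j)\<close> is at least \<open>(1 - 1/r - \<epsilon>)N\<close> and \<open>ex(N, F j) \<le> ex(N, F (s + 2))\<close>
  by the ordering, \<open>G\<close> then has about \<open>n/r\<close> edges fewer than the lower bound construction with
  \<open>s + 1\<close> full vertices. So for a \<open>G\<close> with at least as many edges as that construction, \<open>G - W\<close> is
  \<open>F (s + 1)\<close>-free, and counting edges at \<open>W\<close> yields the theorem.
\<close>

section \<open>Neighbourhoods and edge counts\<close>

definition nbrs :: "'a graph \<Rightarrow> 'a \<Rightarrow> 'a set" where
  "nbrs G x = {y. {x, y} \<in> edges G}"

definition edges_in :: "'a graph \<Rightarrow> 'a set \<Rightarrow> 'a set set" where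
  "edges_in G A = {e \<in> edges G. e \<subseteq> A}"

abbreviation degree_in :: "'a graph \<Rightarrow> 'a set \<Rightarrow> 'a \<Rightarrow> nat" where
  "degree_in G A x \<equiv> card (nbrs G x \<inter> A)"

definition min_degree_ratio_ge :: "'a graph \<Rightarrow> 'a set \<Rightarrow> real \<Rightarrow> bool" where
  "min_degree_ratio_ge G A p \<longleftrightarrow> (\<forall>x\<in>A. p * card A \<le> degree_in G A x)"

definition edge_density_ge :: "'a graph \<Rightarrow> 'a set \<Rightarrow> real \<Rightarrow> bool" where
  "edge_density_ge G A p \<longleftrightarrow> p * (card A)\<^sup>2 / 2 \<le> card (edges_in G A)"

lemma min_degree_ratio_ge_mono: "min_degree_ratio_ge G A p \<Longrightarrow> q \<le> p \<Longrightarrow> min_degree_ratio_ge G A q"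
  unfolding min_degree_ratio_ge_def by (meson mult_right_mono of_nat_0_le_iff order_trans)

lemma finite_verts: "simple_graph G \<Longrightarrow> finite (verts G)"
  by (simp add: simple_graph_def)

lemma finite_edges: "simple_graph G \<Longrightarrow> finite (edges G)"
  by (rule finite_subset[of _ "Pow (verts G)"]) (auto simp: simple_graph_def)

lemma finite_edges_in: "simple_graph G \<Longrightarrow> finite (edges_in G A)"
  using finite_edges[of G] by (simp add: edges_in_def)

lemma edges_in_verts: "simple_graph G \<Longrightarrow> edges_in G (verts G) = edges G"
  by (auto simp: edges_in_def simple_graph_def)

lemma simple_graph_edgeE:
  assumes "simple_graph G" "e \<in> edges G"
  obtains x y where "e = {x, y}" "x \<noteq> y" "x \<in> verts G" "y \<in> verts G"
proof -
  have "card e = 2" "e \<subseteq> verts G"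
    using assms by (auto simp: simple_graph_def)
  then show thesis
    using that by (auto simp: card_2_iff)
qed

lemma nbrs_sym: "y \<in> nbrs G x \<longleftrightarrow> x \<in> nbrs G y"
  by (simp add: nbrs_def insert_commute)

lemma nbrs_irrefl: "simple_graph G \<Longrightarrow> x \<notin> nbrs G x"
  by (auto simp: nbrs_def simple_graph_def)

lemma card_edges_in_remove:
  assumes G: "simple_graph G" and A: "finite A" "v \<in> A"
  shows "card (edges_in G A) = card (edges_in G (A - {v})) + degree_in G A v"
proof -
  define star where "star = (\<lambda>y. {v, y}) ` (nbrs G v \<inter> A)"
  have "e \<in> edges_in G (A - {v}) \<union> star" if e: "e \<in> edges_in G A" for e
  proof -
    have "e \<in> edges G" "e \<subseteq> A"
      using e by (auto simp: edges_in_def)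
    moreover obtain x y where "e = {x, y}"
      using simple_graph_edgeE[OF G \<open>e \<in> edges G\<close>] by metis
    ultimately show ?thesis
      by (auto simp: edges_in_def star_def nbrs_def insert_commute)
  qed
  moreover have "edges_in G (A - {v}) \<union> star \<subseteq> edges_in G A"
    using A(2) by (auto simp: edges_in_def star_def nbrs_def)
  ultimately have "edges_in G A = edges_in G (A - {v}) \<union> star"
    by blast
  moreover have "edges_in G (A - {v}) \<inter> star = {}"
    by (auto simp: edges_in_def star_def)
  moreover have "card star = degree_in G A v"
    unfolding star_def by (intro card_image) (auto simp: inj_on_def doubleton_eq_iff)
  ultimately show ?thesis
    using finite_edges_in[OF G] A(1) by (simp add: card_Un_disjoint star_def)
qed

lemma card_edges_in_le_square:
  assumes "simple_graph G" "finite A"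
  shows "2 * card (edges_in G A) \<le> (card A)\<^sup>2"
  using assms(2)
proof (induction A rule: finite_induct)
  case empty
  have "edges_in G {} = {}"
    using assms(1) by (auto simp: edges_in_def simple_graph_def)
  then show ?case
    by simp
next
  case (insert v A)
  have "degree_in G (insert v A) v \<le> card A"
    using nbrs_irrefl[OF assms(1), of v] insert by (intro card_mono) auto
  with card_edges_in_remove[OF assms(1), of "insert v A" v] insert show ?case
    by (simp add: power2_eq_square)
qed

lemma card_edges_in_Diff_le:
  fixes D :: real
  assumes G: "simple_graph G" and "finite A" "X \<subseteq> A"
    and "\<And>x. x \<in> X \<Longrightarrow> degree_in G A x \<le> D"
  shows "card (edges_in G A) \<le> card (edges_in G (A - X)) + card X * D"
proof -
  have "finite X"
    using assms(2,3) finite_subset by blast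
  then show ?thesis
    using assms(3,4)
  proof (induction X rule: finite_induct)
    case empty
    then show ?case by simp
  next
    case (insert x X)
    have "card (edges_in G (A - X)) = card (edges_in G (A - insert x X)) + degree_in G (A - X) x"
      using card_edges_in_remove[OF G, of "A - X" x] insert assms(2)
      by (simp add: Diff_insert[of A x X])
    moreover have "degree_in G (A - X) x \<le> degree_in G A x"
      using assms(2) by (intro card_mono) auto
    moreover have "degree_in G A x \<le> D"
      using insert by auto
    moreover have "card (edges_in G A) \<le> card (edges_in G (A - X)) + card X * D"
      using insert by auto
    ultimately have "card (edges_in G A) \<le> card (edges_in G (A - insert x X)) + D + card X * D"
      by linarith
    then show ?case
      using insert by (simp add: algebra_simps)
  qed
qed

lemma sum_degree_in_swap:
  assumes "finite S" "finite A"
  shows "(\<Sum>s\<in>S. degree_in G A s) = (\<Sum>x\<in>A. degree_in G S x)"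
proof -
  have "(\<Sum>s\<in>S. card {x \<in> A. x \<in> nbrs G s}) = (\<Sum>x\<in>A. card {s \<in> S. s \<in> nbrs G x})"
    using assms by (intro sum_multicount_gen) (simp_all add: nbrs_sym)
  moreover have "nbrs G x \<inter> B = {y \<in> B. y \<in> nbrs G x}" for x B
    by auto
  ultimately show ?thesis
    by simp
qed

section \<open>Dense subgraphs of large minimum degree\<close>

lemma eventually_less_mult_of_nat:
  fixes b :: real
  assumes "0 < b"
  shows "\<forall>\<^sub>F n in sequentially. C < b * of_nat n"
proof -
  have "\<forall>\<^sub>F n in sequentially. C / b < of_nat n"
    using filterlim_real_sequentially by (simp add: filterlim_at_top_dense)
  then show ?thesis
    using assms by (simp add: pos_divide_less_eq mult.commute)
qed

text \<open>A maximiser of \<open>e(A) - c|A|\<^sup>2/2\<close> cannot gain by losing a vertex.\<close>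

lemma exists_subset_min_degree:
  fixes c :: real
  assumes G: "simple_graph G" and "finite V"
  shows "\<exists>A\<subseteq>V. (\<forall>v\<in>A. c * (card A - 1/2) \<le> degree_in G A v) \<and>
    card (edges_in G V) - c * (card V)\<^sup>2 / 2 \<le> card (edges_in G A) - c * (card A)\<^sup>2 / 2"
proof -
  define \<phi> where "\<phi> A = card (edges_in G A) - c * (card A)\<^sup>2 / 2" for A
  obtain A where A: "A \<subseteq> V" "Max (\<phi> ` Pow V) = \<phi> A"
    using obtains_MAX[of "Pow V" \<phi>] assms(2) by auto
  have max: "\<phi> B \<le> \<phi> A" if "B \<subseteq> V" for B
    using that assms(2) A(2)[symmetric] by simp
  have finA: "finite A"
    using A(1) assms(2) finite_subset by blast
  have "c * (card A - 1/2) \<le> degree_in G A v" if v: "v \<in> A" for v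
  proof -
    have "\<phi> (A - {v}) \<le> \<phi> A"
      using A(1) by (intro max) auto
    moreover have "real (card (A - {v})) = real (card A) - 1"
      using card.remove[OF finA v] by simp
    ultimately have "card (edges_in G A) - degree_in G A v - c * (real (card A) - 1)\<^sup>2 / 2
        \<le> card (edges_in G A) - c * (card A)\<^sup>2 / 2"
      using card_edges_in_remove[OF G finA v] by (simp add: \<phi>_def)
    moreover have "c * (real (card A) - 1)\<^sup>2 / 2 = c * (card A)\<^sup>2 / 2 - c * (card A - 1/2)"
      by (simp add: power2_eq_square algebra_simps add_divide_distrib diff_divide_distrib)
    ultimately show ?thesis
      by linarith
  qed
  then show ?thesis
    using A(1) max[of V] by (auto simp: \<phi>_def)
qed

lemma exists_large_subset_min_degree:
  fixes c \<eta> :: real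
  assumes G: "simple_graph G" "finite V" and c_ge: "-1 \<le> c"
    and dense: "edge_density_ge G V (c + \<eta>)"
  shows "\<exists>A\<subseteq>V. \<eta> * card V \<le> 2 * card A \<and> (\<forall>v\<in>A. c * (card A - 1/2) \<le> degree_in G A v) \<and>
    \<eta> * (card V)\<^sup>2 / 2 \<le> card (edges_in G A) - c * (card A)\<^sup>2 / 2"
proof -
  obtain A where A: "A \<subseteq> V" "\<forall>v\<in>A. c * (card A - 1/2) \<le> degree_in G A v"
    "card (edges_in G V) - c * (card V)\<^sup>2 / 2 \<le> card (edges_in G A) - c * (card A)\<^sup>2 / 2"
    using exists_subset_min_degree[OF G, of c] by blast
  have "(c + \<eta>) * (card V)\<^sup>2 / 2 = \<eta> * (card V)\<^sup>2 / 2 + c * (card V)\<^sup>2 / 2"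
    by (simp add: algebra_simps add_divide_distrib)
  then have gain: "\<eta> * (card V)\<^sup>2 / 2 \<le> card (edges_in G A) - c * (card A)\<^sup>2 / 2"
    using dense A(3) unfolding edge_density_ge_def by linarith
  have "2 * card (edges_in G A) \<le> (card A)\<^sup>2"
    using G A(1) finite_subset by (intro card_edges_in_le_square) blast+
  then have "2 * real (card (edges_in G A)) \<le> (real (card A))\<^sup>2"
    by (metis of_nat_le_iff of_nat_mult of_nat_numeral of_nat_power)
  moreover have "-1 * real ((card A)\<^sup>2) \<le> c * (card A)\<^sup>2"
    using c_ge by (intro mult_right_mono) auto
  ultimately have "\<eta> * (real (card V))\<^sup>2 \<le> 2 * (real (card A))\<^sup>2"
    using gain by simp
  also have "\<dots> \<le> 2 * card A * card V"
    using A(1) G(2) by (simp add: power2_eq_square card_mono mult_left_mono)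
  finally have "(\<eta> * card V) * card V \<le> (2 * card A) * card V"
    by (simp add: power2_eq_square mult.assoc)
  then have "\<eta> * card V \<le> 2 * card A"
    by (cases "card V = 0") auto
  then show ?thesis
    using A(1,2) gain by blast
qed

section \<open>Complete multipartite subgraphs\<close>

definition turan_density :: "nat \<Rightarrow> real" where
  "turan_density q = 1 - 1 / q"

lemma turan_density_le_one: "turan_density q \<le> 1"
  by (simp add: turan_density_def)

lemma turan_density_nonneg: "1 \<le> q \<Longrightarrow> 0 \<le> turan_density q"
  by (simp add: turan_density_def)

lemma turan_density_ge_half: "2 \<le> q \<Longrightarrow> 1 / 2 \<le> turan_density q"
  by (simp add: turan_density_def field_simps)

lemma turan_density_mono: "1 \<le> p \<Longrightarrow> p \<le> q \<Longrightarrow> turan_density p \<le> turan_density q"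
  by (simp add: turan_density_def frac_le)

lemma mult_turan_density: "1 \<le> q \<Longrightarrow> q * turan_density q = real q - 1"
  by (simp add: turan_density_def field_simps)

definition multipartite_in :: "'a graph \<Rightarrow> nat \<Rightarrow> (nat \<Rightarrow> 'a set) \<Rightarrow> 'a set \<Rightarrow> bool" where
  "multipartite_in G q S A \<longleftrightarrow> (\<forall>i<q. S i \<subseteq> A) \<and>
     (\<forall>i<q. \<forall>j<q. i \<noteq> j \<longrightarrow> (\<forall>x\<in>S i. \<forall>y\<in>S j. {x, y} \<in> edges G))"

definition has_multipartite :: "'a graph \<Rightarrow> nat \<Rightarrow> nat \<Rightarrow> 'a set \<Rightarrow> bool" where
  "has_multipartite G q t A \<longleftrightarrow> (\<exists>S. multipartite_in G q S A \<and> (\<forall>i<q. card (S i) = t))"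

lemma multipartite_in_mono:
  assumes "multipartite_in G q S A" "\<And>i. i < q \<Longrightarrow> R i \<subseteq> S i \<inter> B"
  shows "multipartite_in G q R B"
  using assms unfolding multipartite_in_def by (meson Int_iff subset_eq)

lemma multipartite_in_fun_upd:
  assumes S: "multipartite_in G q S A" and R: "R \<subseteq> A"
    and adj: "\<And>i x y. i < q \<Longrightarrow> x \<in> S i \<Longrightarrow> y \<in> R \<Longrightarrow> {x, y} \<in> edges G"
  shows "multipartite_in G (Suc q) (S(q := R)) A"
  unfolding multipartite_in_def
proof (intro conjI allI impI ballI)
  fix i assume "i < Suc q"
  then show "(S(q := R)) i \<subseteq> A"
    using S R by (auto simp: multipartite_in_def less_Suc_eq)
next
  fix i j x y
  assume "i < Suc q" "j < Suc q" "i \<noteq> j" "x \<in> (S(q := R)) i" "y \<in> (S(q := R)) j"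
  then consider "i < q" "j < q" "x \<in> S i" "y \<in> S j" | "i < q" "x \<in> S i" "y \<in> R"
    | "j < q" "x \<in> R" "y \<in> S j"
    by (auto simp: less_Suc_eq)
  then show "{x, y} \<in> edges G"
  proof cases
    case 1
    then show ?thesis
      using S \<open>i \<noteq> j\<close> by (simp add: multipartite_in_def)
  next
    case 2
    then show ?thesis
      by (rule adj)
  next
    case 3
    then show ?thesis
      using adj[of j y x] by (simp add: insert_commute)
  qed
qed

lemma has_multipartite_mono: "has_multipartite G q t A \<Longrightarrow> A \<subseteq> B \<Longrightarrow> has_multipartite G q t B"
  by (auto simp: has_multipartite_def multipartite_in_def intro: order_trans)

lemma has_multipartite_one:
  assumes "t \<le> card A"
  shows "has_multipartite G 1 t A"
proof -
  obtain S where "S \<subseteq> A" "card S = t"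
    using assms by (meson obtain_subset_with_card_n)
  then show ?thesis
    unfolding has_multipartite_def multipartite_in_def by (intro exI[of _ "\<lambda>_. S"]) auto
qed

lemma sum_degree_in_classes_ge:
  fixes d :: real
  assumes A: "finite A" and S: "\<And>i. i < q \<Longrightarrow> S i \<subseteq> A" "\<And>i. i < q \<Longrightarrow> card (S i) = T"
    and deg: "\<And>i s. i < q \<Longrightarrow> s \<in> S i \<Longrightarrow> d \<le> degree_in G A s"
  shows "real q * T * d \<le> (\<Sum>x\<in>A. \<Sum>i<q. real (degree_in G (S i) x))"
proof -
  have "real q * T * d = (\<Sum>i<q. \<Sum>s\<in>S i. d)"
    using S(2) by simp
  also have "\<dots> \<le> (\<Sum>i<q. \<Sum>s\<in>S i. real (degree_in G A s))"
    using deg by (intro sum_mono) auto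
  also have "\<dots> = (\<Sum>i<q. \<Sum>x\<in>A. real (degree_in G (S i) x))"
    using sum_degree_in_swap[OF finite_subset[OF S(1) A] A, of _ G]
    by (simp flip: of_nat_sum)
  also have "\<dots> = (\<Sum>x\<in>A. \<Sum>i<q. real (degree_in G (S i) x))"
    by (rule sum.swap)
  finally show ?thesis .
qed

lemma sum_bounded_above_except:
  fixes f :: "'a \<Rightarrow> real"
  assumes I: "finite I" "k \<in> I" and k: "f k \<le> t" and others: "\<And>i. i \<in> I \<Longrightarrow> i \<noteq> k \<Longrightarrow> f i \<le> T"
  shows "sum f I \<le> t + (real (card I) - 1) * T"
proof -
  have "sum f (I - {k}) \<le> of_nat (card (I - {k})) * T"
    using others by (intro sum_bounded_above) auto
  moreover have "real (card (I - {k})) = real (card I) - 1"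
    using card.remove[OF I] by simp
  ultimately show ?thesis
    using sum.remove[OF I, of f] k by simp
qed

lemma degree_in_le_card: "finite S \<Longrightarrow> degree_in G S x \<le> card S"
  by (simp add: card_mono)

lemma sum_degree_in_classes_le_if_small:
  fixes T t :: real
  assumes q: "1 \<le> q" "0 \<le> T" and degree_le: "\<And>i. i < q \<Longrightarrow> degree_in G (S i) x \<le> T" "0 \<le> t"
  shows "(\<Sum>i<q. real (degree_in G (S i) x)) \<le>
    t + (real q - 1) * T + (if \<forall>i<q. t \<le> degree_in G (S i) x then real q * T else 0)"
proof (cases "\<forall>i<q. t \<le> degree_in G (S i) x")
  case True
  have "(\<Sum>i<q. real (degree_in G (S i) x)) \<le> of_nat (card {..<q}) * T"
    using degree_le(1) by (intro sum_bounded_above) auto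
  moreover have "0 \<le> (real q - 1) * T"
    using q by simp
  ultimately show ?thesis
    using True degree_le(2) by simp
next
  case False
  then obtain k where "k < q" "degree_in G (S k) x < t"
    by (auto simp: not_le)
  then have "(\<Sum>i<q. real (degree_in G (S i) x)) \<le> t + (real (card {..<q}) - 1) * T"
    using degree_le(1) by (intro sum_bounded_above_except[of _ k]) auto
  then show ?thesis
    unfolding if_not_P[OF False] by simp
qed

lemma many_vertices_adjacent_to_all_classes:
  fixes \<epsilon> :: real
  assumes A: "finite A" and q: "1 \<le> q"
    and S: "\<And>i. i < q \<Longrightarrow> S i \<subseteq> A" "\<And>i. i < q \<Longrightarrow> card (S i) = T"
    and deg: "min_degree_ratio_ge G A (turan_density q + \<epsilon>)"
    and T: "2 * real t \<le> \<epsilon> * q * T" "1 \<le> T"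
  shows "\<epsilon> * card A / 2 \<le> card {x \<in> A. \<forall>i<q. t \<le> degree_in G (S i) x}"
proof -
  define U where "U = {x \<in> A. \<forall>i<q. t \<le> degree_in G (S i) x}"
  have vertex: "(\<Sum>i<q. real (degree_in G (S i) x)) \<le>
      t + (real q - 1) * T + (if x \<in> U then real q * T else 0)" if x: "x \<in> A" for x
  proof -
    have "real (degree_in G (S i) x) \<le> T" if "i < q" for i
      using degree_in_le_card[OF finite_subset[OF S(1)[OF that] A]] S(2)[OF that] by simp
    then show ?thesis
      using sum_degree_in_classes_le_if_small[where S = S and T = T and t = t] q x
      by (simp add: U_def)
  qed
  have "real q * T * ((turan_density q + \<epsilon>) * card A) \<le> (\<Sum>x\<in>A. \<Sum>i<q. real (degree_in G (S i) x))"
    using deg S(1) by (intro sum_degree_in_classes_ge[OF A S]) (auto simp: min_degree_ratio_ge_def)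
  also have "\<dots> \<le> (\<Sum>x\<in>A. t + (real q - 1) * T + (if x \<in> U then real q * T else 0))"
    by (intro sum_mono vertex)
  also have "\<dots> = card A * (t + (real q - 1) * T) + card U * (real q * T)"
  proof -
    have "A \<inter> U = U"
      by (auto simp: U_def)
    then show ?thesis
      using A by (simp add: sum.distrib sum.If_cases)
  qed
  finally have "real q * T * ((turan_density q + \<epsilon>) * card A) \<le>
      card A * (t + (real q - 1) * T) + card U * (real q * T)" .
  moreover have "real q * T * ((turan_density q + \<epsilon>) * card A) =
      card A * ((q * turan_density q) * T + \<epsilon> * q * T)"
    by (simp add: algebra_simps)
  ultimately have "card A * (\<epsilon> * q * T - t) \<le> card U * (real q * T)"
    unfolding mult_turan_density[OF q] by (simp add: algebra_simps)
  moreover have "card A * (\<epsilon> * q * T / 2) \<le> card A * (\<epsilon> * q * T - t)"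
    using T(1) by (intro mult_left_mono) linarith+
  ultimately have "(\<epsilon> * card A / 2) * (q * T) \<le> card U * (real q * T)"
    by (simp add: algebra_simps)
  then show ?thesis
    using q T(2) by (simp add: U_def mult_le_cancel_right)
qed

lemma exists_subset_same_trace:
  assumes "finite U" "finite P" "card P \<le> p" "t * 2 ^ p \<le> card U"
  shows "\<exists>R\<subseteq>U. card R = t \<and> (\<forall>x\<in>R. \<forall>y\<in>R. nbrs G x \<inter> P = nbrs G y \<inter> P)"
proof -
  define trace where "trace x = nbrs G x \<inter> P" for x
  obtain Y where Y: "card U \<le> card (trace -` {Y} \<inter> U) * card (Pow P)"
    using pigeonhole_card[of trace U "Pow P"] assms(1,2) by (auto simp: trace_def)
  have "t * card (Pow P) \<le> t * 2 ^ p"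
    using assms(2,3) by (simp add: card_Pow)
  then have "t * card (Pow P) \<le> card (trace -` {Y} \<inter> U) * card (Pow P)"
    using Y assms(4) by linarith
  then have "t \<le> card (trace -` {Y} \<inter> U)"
    using assms(2) by (simp add: card_Pow)
  then obtain R where "R \<subseteq> trace -` {Y} \<inter> U" "card R = t"
    by (meson obtain_subset_with_card_n)
  moreover from this have "trace x = Y" if "x \<in> R" for x
    using that by auto
  ultimately show ?thesis
    by (intro exI[of _ R]) (auto simp: trace_def)
qed

lemma has_multipartite_Suc_if_same_trace:
  assumes S: "multipartite_in G q S A" and R: "R \<subseteq> A" "card R = t"
    and deg: "\<And>x i. x \<in> R \<Longrightarrow> i < q \<Longrightarrow> t \<le> degree_in G (S i) x"
    and trace: "\<forall>x\<in>R. \<forall>y\<in>R. nbrs G x \<inter> (\<Union>i<q. S i) = nbrs G y \<inter> (\<Union>i<q. S i)"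
  shows "has_multipartite G (Suc q) t A"
proof -
  have "\<exists>Q. Q \<subseteq> S i \<and> card Q = t \<and> (\<forall>x\<in>R. Q \<subseteq> nbrs G x)" if i: "i < q" for i
  proof (cases "R = {}")
    case True
    then show ?thesis
      using R(2) by (intro exI[of _ "{}"]) simp
  next
    case False
    then obtain x where x: "x \<in> R"
      by blast
    then obtain Q where Q: "Q \<subseteq> nbrs G x \<inter> S i" "card Q = t"
      using deg[OF x i] by (meson obtain_subset_with_card_n)
    have "S i \<subseteq> (\<Union>i<q. S i)"
      using i by auto
    then have "nbrs G x \<inter> S i \<subseteq> nbrs G y" if "y \<in> R" for y
      using trace x that by blast
    then show ?thesis
      using Q by blast
  qed
  then obtain Q where Q: "\<And>i. i < q \<Longrightarrow> Q i \<subseteq> S i \<and> card (Q i) = t \<and> (\<forall>x\<in>R. Q i \<subseteq> nbrs G x)"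
    by metis
  have "S i \<subseteq> A" if "i < q" for i
    using S that by (simp add: multipartite_in_def)
  then have "multipartite_in G q Q A"
    using Q by (intro multipartite_in_mono[OF S]) blast
  then have "multipartite_in G (Suc q) (Q(q := R)) A"
  proof (rule multipartite_in_fun_upd)
    show "{x, y} \<in> edges G" if "i < q" "x \<in> Q i" "y \<in> R" for i x y
    proof -
      have "x \<in> nbrs G y"
        using Q that by blast
      then show ?thesis
        by (simp add: nbrs_def insert_commute)
    qed
  qed (rule R(1))
  moreover have "card ((Q(q := R)) i) = t" if "i < Suc q" for i
    using Q R(2) that by (auto simp: less_Suc_eq)
  ultimately show ?thesis
    unfolding has_multipartite_def by blast
qed

lemma extend_multipartite:
  fixes \<epsilon> :: real
  assumes A: "finite A" and q: "1 \<le> q" and deg: "min_degree_ratio_ge G A (turan_density q + \<epsilon>)"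
    and T: "2 * real t \<le> \<epsilon> * q * T" "1 \<le> T"
    and large: "2 * real t * 2 ^ (q * T) \<le> \<epsilon> * card A"
    and multipartite: "has_multipartite G q T A"
  shows "has_multipartite G (Suc q) t A"
proof -
  obtain S where S: "multipartite_in G q S A" "\<And>i. i < q \<Longrightarrow> card (S i) = T"
    using multipartite unfolding has_multipartite_def by blast
  have SA: "S i \<subseteq> A" if "i < q" for i
    using S(1) that by (simp add: multipartite_in_def)
  define U where "U = {x \<in> A. \<forall>i<q. t \<le> degree_in G (S i) x}"
  have "\<epsilon> * card A / 2 \<le> card U"
    unfolding U_def
    by (rule many_vertices_adjacent_to_all_classes[where S = S and T = T])
      (use A q SA S(2) deg T in auto)
  then have "real (t * 2 ^ (q * T)) \<le> card U"
    using large by simp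
  then have "t * 2 ^ (q * T) \<le> card U"
    by linarith
  moreover have "finite (\<Union>i<q. S i)"
    using finite_subset[OF SA A] by simp
  moreover have "card (\<Union>i<q. S i) \<le> q * T"
    using card_UN_le[of "{..<q}" S] S(2) by simp
  moreover have "finite U"
    using A by (simp add: U_def)
  ultimately obtain R where R: "R \<subseteq> U" "card R = t"
      "\<forall>x\<in>R. \<forall>y\<in>R. nbrs G x \<inter> (\<Union>i<q. S i) = nbrs G y \<inter> (\<Union>i<q. S i)"
    using exists_subset_same_trace[of U "\<Union>i<q. S i" "q * T" t G] by blast
  then show ?thesis
    by (intro has_multipartite_Suc_if_same_trace[OF S(1) _ R(2) _ R(3)]) (auto simp: U_def)
qed

lemma eventually_extend_multipartite:
  fixes \<epsilon> :: real
  assumes q: "1 \<le> q" and eps: "0 < \<epsilon>"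
  obtains T where "\<forall>\<^sub>F n in sequentially. \<forall>(G :: 'a graph) A. finite A \<longrightarrow> card A = n \<longrightarrow>
    min_degree_ratio_ge G A (turan_density q + \<epsilon>) \<longrightarrow>
    has_multipartite G q T A \<longrightarrow> has_multipartite G (Suc q) t A"
proof -
  define T where "T = max 1 (nat \<lceil>2 * real t / (\<epsilon> * q)\<rceil>)"
  have "2 * real t / (\<epsilon> * q) \<le> T"
    unfolding T_def by linarith
  then have T: "2 * real t \<le> \<epsilon> * q * T" "1 \<le> T"
    using q eps by (auto simp: T_def pos_divide_le_eq mult.commute)
  have "\<forall>\<^sub>F n in sequentially. 2 * real t * 2 ^ (q * T) < \<epsilon> * n"
    using eps by (rule eventually_less_mult_of_nat)
  then show thesis
  proof (intro that[of T], eventually_elim, intro allI impI)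
    fix n and G :: "'a graph" and A
    assume n: "2 * real t * 2 ^ (q * T) < \<epsilon> * n" and A: "finite A" "card A = n"
      and deg: "min_degree_ratio_ge G A (turan_density q + \<epsilon>)"
      and multipartite: "has_multipartite G q T A"
    have "2 * real t * 2 ^ (q * T) \<le> \<epsilon> * card A"
      using n A(2) by simp
    then show "has_multipartite G (Suc q) t A"
      using extend_multipartite[OF A(1) q _ T _ multipartite] deg by blast
  qed
qed

lemma min_degree_has_multipartite:
  fixes \<epsilon> :: real
  assumes "1 \<le> q" "0 < \<epsilon>"
  shows "\<forall>\<^sub>F n in sequentially. \<forall>(G :: 'a graph) A. finite A \<longrightarrow> card A = n \<longrightarrow>
    min_degree_ratio_ge G A (turan_density q + \<epsilon>) \<longrightarrow> has_multipartite G (Suc q) t A"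
  using assms(1)
proof (induction q arbitrary: t rule: dec_induct)
  case base
  obtain T where "\<forall>\<^sub>F n in sequentially. \<forall>(G :: 'a graph) A. finite A \<longrightarrow> card A = n \<longrightarrow>
      min_degree_ratio_ge G A (turan_density 1 + \<epsilon>) \<longrightarrow>
      has_multipartite G 1 T A \<longrightarrow> has_multipartite G (Suc 1) t A"
    using assms(2) by (rule eventually_extend_multipartite[OF order_refl])
  moreover have "\<forall>\<^sub>F n in sequentially. T \<le> n"
    by (rule eventually_ge_at_top)
  ultimately show ?case
  proof eventually_elim
    case (elim n)
    then show ?case
      using has_multipartite_one by blast
  qed
next
  case (step q)
  then have "1 \<le> Suc q"
    by simp
  then obtain T where "\<forall>\<^sub>F n in sequentially. \<forall>(G :: 'a graph) A. finite A \<longrightarrow> card A = n \<longrightarrow>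
      min_degree_ratio_ge G A (turan_density (Suc q) + \<epsilon>) \<longrightarrow>
      has_multipartite G (Suc q) T A \<longrightarrow> has_multipartite G (Suc (Suc q)) t A"
    using assms(2) by (rule eventually_extend_multipartite)
  then show ?case
    using step.IH[of T]
  proof eventually_elim
    case (elim n)
    have "turan_density q + \<epsilon> \<le> turan_density (Suc q) + \<epsilon>"
      using step.hyps by (simp add: turan_density_mono)
    then have "has_multipartite G (Suc q) T A"
      if "finite A" "card A = n" "min_degree_ratio_ge G A (turan_density (Suc q) + \<epsilon>)"
      for G :: "'a graph" and A
      using elim(2) that min_degree_ratio_ge_mono by blast
    then show ?case
      using elim(1) by blast
  qed
qed

theorem erdos_stone:
  fixes \<epsilon> :: real
  assumes q: "1 \<le> q" and eps: "0 < \<epsilon>"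
  shows "\<forall>\<^sub>F n in sequentially. \<forall>(G :: 'a graph) V. simple_graph G \<longrightarrow> finite V \<longrightarrow> card V = n \<longrightarrow>
    edge_density_ge G V (turan_density q + \<epsilon>) \<longrightarrow> has_multipartite G (Suc q) t V"
proof -
  have "0 < \<epsilon> / 4"
    using eps by simp
  from min_degree_has_multipartite[OF q this, of t]
  obtain n1 where n1: "\<And>(G :: 'a graph) A. finite A \<Longrightarrow> n1 \<le> card A \<Longrightarrow>
      min_degree_ratio_ge G A (turan_density q + \<epsilon> / 4) \<Longrightarrow> has_multipartite G (Suc q) t A"
    unfolding eventually_sequentially by blast
  define c where "c = turan_density q + \<epsilon> / 2"
  have c_nonneg: "0 \<le> c"
    using turan_density_nonneg[OF q] eps by (simp add: c_def)
  have "\<forall>\<^sub>F n in sequentially. max n1 (2 * c / \<epsilon>) < \<epsilon> / 4 * n"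
    using eps by (intro eventually_less_mult_of_nat) simp
  then show ?thesis
  proof (eventually_elim, intro allI impI)
    fix n and G :: "'a graph" and V
    assume n: "max n1 (2 * c / \<epsilon>) < \<epsilon> / 4 * n" and G: "simple_graph G" "finite V" "card V = n"
      and dense: "edge_density_ge G V (turan_density q + \<epsilon>)"
    have "edge_density_ge G V (c + \<epsilon> / 2)"
      using dense by (simp add: c_def add.assoc)
    then obtain A where A: "A \<subseteq> V" "\<epsilon> / 2 * card V \<le> 2 * card A"
        "\<forall>x\<in>A. c * (card A - 1/2) \<le> degree_in G A x"
      using exists_large_subset_min_degree[OF G(1,2), of c "\<epsilon> / 2"] c_nonneg by force
    have "n1 \<le> card A" "2 * c / \<epsilon> \<le> card A"
      using n A(2) G(3) by auto
    then have large: "n1 \<le> card A" "c / 2 \<le> \<epsilon> / 4 * card A"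
      using eps by (auto simp: field_simps)
    have "(turan_density q + \<epsilon> / 4) * card A \<le> c * (card A - 1/2)"
      using large(2) by (simp add: c_def algebra_simps)
    then have "has_multipartite G (Suc q) t A"
      using A(1,3) large(1) G(2)
      by (intro n1) (auto simp: min_degree_ratio_ge_def intro: finite_subset order_trans)
    then show "has_multipartite G (Suc q) t V"
      using A(1) by (rule has_multipartite_mono)
  qed
qed

section \<open>Graphs of nearly extremal density\<close>

lemma almost_full_if_square_gain:
  fixes a n \<epsilon> :: real
  assumes a: "0 \<le> a" "a \<le> n" and n: "0 < n" and eps: "0 < \<epsilon>"
    and gain: "(\<epsilon> / 2 - \<epsilon>\<^sup>2 / 4) * n\<^sup>2 \<le> (\<epsilon> / 2 + \<epsilon>\<^sup>2 / 4) * a\<^sup>2"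
  shows "(1 - \<epsilon>) * n \<le> a"
proof -
  have "\<epsilon> / 2 * (n\<^sup>2 - a\<^sup>2) \<le> \<epsilon>\<^sup>2 / 4 * (n\<^sup>2 + a\<^sup>2)"
    using gain by (simp add: algebra_simps)
  also have "\<dots> \<le> \<epsilon>\<^sup>2 / 4 * (2 * n\<^sup>2)"
    using a by (intro mult_left_mono) (auto intro: power_mono)
  also have "\<dots> = \<epsilon> / 2 * (\<epsilon> * n\<^sup>2)"
    by (simp add: power2_eq_square)
  finally have "n\<^sup>2 - a\<^sup>2 \<le> \<epsilon> * n\<^sup>2"
    using eps by simp
  moreover have "a\<^sup>2 \<le> a * n"
    using a by (simp add: power2_eq_square mult_left_mono)
  ultimately have "(1 - \<epsilon>) * n * n \<le> a * n"
    by (simp add: power2_eq_square algebra_simps)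
  then show ?thesis
    using n by simp
qed

text \<open>The subset is a maximiser of \<open>e(A) - c|A|\<^sup>2/2\<close> with \<open>c\<close> slightly below \<open>p\<close>: the density
  bound on large sets forces the maximiser to be almost everything.\<close>

lemma almost_regular_subset_if_uniform_density:
  fixes p \<epsilon> m :: real
  assumes G: "simple_graph G" "finite V" and p: "0 \<le> p" "p \<le> 1" and eps: "0 < \<epsilon>" "\<epsilon> \<le> 1"
    and dense: "edge_density_ge G V (p - \<epsilon>\<^sup>2 / 4)"
    and sparse: "\<And>A. A \<subseteq> V \<Longrightarrow> m \<le> card A \<Longrightarrow> \<not> edge_density_ge G A (p + \<epsilon>\<^sup>2 / 4)"
    and large: "max m (1 / \<epsilon>) < \<epsilon> / 8 * card V"
  shows "\<exists>A\<subseteq>V. (1 - \<epsilon>) * card V \<le> card A \<and> min_degree_ratio_ge G A (p - \<epsilon>)"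
proof -
  define c where "c = p - \<epsilon> / 2"
  define \<eta> where "\<eta> = \<epsilon> / 2 - \<epsilon>\<^sup>2 / 4"
  have "edge_density_ge G V (c + \<eta>)"
    using dense by (simp add: c_def \<eta>_def)
  moreover have c_bounds: "c \<le> 1" "-1 \<le> c"
    using p eps by (auto simp: c_def)
  ultimately obtain A where A: "A \<subseteq> V" "\<eta> * card V \<le> 2 * card A"
      and deg: "\<forall>x\<in>A. c * (card A - 1/2) \<le> degree_in G A x"
      and gain: "\<eta> * (card V)\<^sup>2 / 2 \<le> card (edges_in G A) - c * (card A)\<^sup>2 / 2"
    using exists_large_subset_min_degree[OF G] by blast
  have "\<epsilon>\<^sup>2 \<le> \<epsilon>"
    using eps by (simp add: power2_eq_square mult_left_le)
  then have "\<epsilon> / 4 * card V \<le> \<eta> * card V"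
    by (intro mult_right_mono) (auto simp: \<eta>_def)
  then have "m \<le> card A" "1 / \<epsilon> \<le> card A"
    using A(2) large by linarith+
  have "card (edges_in G A) \<le> (p + \<epsilon>\<^sup>2 / 4) * (card A)\<^sup>2 / 2"
    using sparse[OF A(1) \<open>m \<le> card A\<close>] by (simp add: edge_density_ge_def)
  moreover have "(p + \<epsilon>\<^sup>2 / 4) * (card A)\<^sup>2 / 2 - c * (card A)\<^sup>2 / 2 =
    (\<epsilon> / 2 + \<epsilon>\<^sup>2 / 4) * (card A)\<^sup>2 / 2"
    by (simp add: c_def algebra_simps add_divide_distrib diff_divide_distrib)
  ultimately have "\<eta> * (card V)\<^sup>2 / 2 \<le> (\<epsilon> / 2 + \<epsilon>\<^sup>2 / 4) * (card A)\<^sup>2 / 2"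
    using gain by linarith
  then have "\<eta> * (card V)\<^sup>2 \<le> (\<epsilon> / 2 + \<epsilon>\<^sup>2 / 4) * (card A)\<^sup>2"
    by simp
  moreover have "0 < card V"
    using large eps(1) by (cases "card V") auto
  ultimately have "(1 - \<epsilon>) * card V \<le> card A"
    using A(1) G(2) eps(1) by (intro almost_full_if_square_gain) (auto simp: \<eta>_def card_mono)
  moreover have "1 \<le> \<epsilon> * card A"
    using \<open>1 / \<epsilon> \<le> card A\<close> eps(1) by (simp add: pos_divide_le_eq mult.commute)
  then have "(p - \<epsilon>) * card A \<le> c * (card A - 1/2)"
    using c_bounds(1) by (simp add: c_def algebra_simps)
  then have "min_degree_ratio_ge G A (p - \<epsilon>)"
    using deg order_trans unfolding min_degree_ratio_ge_def by blast
  ultimately show ?thesis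
    using A(1) by blast
qed

definition near_extremal :: "nat \<Rightarrow> nat \<Rightarrow> real \<Rightarrow> 'a graph \<Rightarrow> 'a set \<Rightarrow> bool" where
  "near_extremal r t \<delta> G V \<longleftrightarrow> simple_graph G \<and> finite V \<and>
     edge_density_ge G V (turan_density r - \<delta>) \<and> \<not> has_multipartite G (Suc r) t V"

lemma near_extremal_almost_regular:
  fixes \<epsilon> :: real
  assumes q: "1 \<le> q" and eps: "0 < \<epsilon>" "\<epsilon> \<le> 1"
  obtains \<delta> where "0 < \<delta>"
    "\<forall>\<^sub>F n in sequentially. \<forall>(G :: 'a graph) V. near_extremal q t \<delta> G V \<longrightarrow> card V = n \<longrightarrow>
      (\<exists>A\<subseteq>V. (1 - \<epsilon>) * card V \<le> card A \<and> min_degree_ratio_ge G A (turan_density q - \<epsilon>))"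
proof -
  define \<delta> where "\<delta> = \<epsilon>\<^sup>2 / 4"
  have delta: "0 < \<delta>"
    using eps(1) by (simp add: \<delta>_def)
  from erdos_stone[OF q this, of t]
  obtain n1 where n1: "\<And>(G :: 'a graph) A. simple_graph G \<Longrightarrow> finite A \<Longrightarrow> n1 \<le> card A \<Longrightarrow>
      edge_density_ge G A (turan_density q + \<delta>) \<Longrightarrow> has_multipartite G (Suc q) t A"
    unfolding eventually_sequentially by blast
  have "\<forall>\<^sub>F n in sequentially. max n1 (1 / \<epsilon>) < \<epsilon> / 8 * n"
    using eps(1) by (intro eventually_less_mult_of_nat) simp
  then show thesis
  proof (intro that[OF delta], eventually_elim, intro allI impI)
    fix n and G :: "'a graph" and V
    assume n: "max n1 (1 / \<epsilon>) < \<epsilon> / 8 * n" and "near_extremal q t \<delta> G V" and card: "card V = n"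
    then have G: "simple_graph G" "finite V" and dense: "edge_density_ge G V (turan_density q - \<delta>)"
      and free: "\<not> has_multipartite G (Suc q) t V"
      by (auto simp: near_extremal_def)
    have "\<not> edge_density_ge G A (turan_density q + \<delta>)" if "A \<subseteq> V" "real n1 \<le> card A" for A
    proof -
      have "\<not> has_multipartite G (Suc q) t A"
        using free that(1) has_multipartite_mono by blast
      then show ?thesis
        using n1[OF G(1)] that finite_subset[OF that(1) G(2)] by auto
    qed
    then show "\<exists>A\<subseteq>V. (1 - \<epsilon>) * card V \<le> card A \<and> min_degree_ratio_ge G A (turan_density q - \<epsilon>)"
      using n dense card turan_density_nonneg[OF q] turan_density_le_one[of q] eps
      unfolding \<delta>_def by (intro almost_regular_subset_if_uniform_density[OF G, of _ _ n1]) auto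
  qed
qed

lemma min_degree_ratio_ge_almost_full_subset:
  fixes \<delta> :: real
  assumes q: "1 \<le> q" and delta: "0 < \<delta>" and A: "finite A"
    and deg: "min_degree_ratio_ge G A (turan_density (Suc q) - \<delta>)"
    and B: "B \<subseteq> A" "(turan_density (Suc q) + 2 * real q * \<delta>) * card A \<le> card B"
  shows "min_degree_ratio_ge G B (turan_density q + \<delta>)"
  unfolding min_degree_ratio_ge_def
proof
  fix x assume x: "x \<in> B"
  have finB: "finite B" and BA: "card B \<le> card A"
    using B(1) A finite_subset card_mono by blast+
  have "nbrs G x \<inter> A \<subseteq> (nbrs G x \<inter> B) \<union> (A - B)"
    by blast
  then have "degree_in G A x \<le> degree_in G B x + card (A - B)"
    using A finB by (meson card_Un_le card_mono finite_Diff finite_Int finite_UnI le_trans)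
  moreover have "real (card (A - B)) = real (card A) - card B"
    using finB B(1) BA by (simp add: card_Diff_subset of_nat_diff)
  moreover have "(turan_density (Suc q) - \<delta>) * card A \<le> degree_in G A x"
    using deg x B(1) by (auto simp: min_degree_ratio_ge_def)
  ultimately have lower: "card B - (1 / Suc q + \<delta>) * card A \<le> degree_in G B x"
    by (simp add: turan_density_def algebra_simps)
  have "q * ((1 / Suc q + \<delta>) * card A) + q * \<delta> * card B \<le>
    q * ((1 / Suc q + \<delta>) * card A) + q * \<delta> * card A"
    using BA delta by (intro add_left_mono mult_left_mono) auto
  also have "\<dots> = (turan_density (Suc q) + 2 * real q * \<delta>) * card A"
    by (simp add: turan_density_def field_simps)
  also have "\<dots> \<le> card B"
    by (rule B(2))
  finally have "(1 / Suc q + \<delta>) * card A \<le> (1 / q - \<delta>) * card B"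
    using q by (simp add: field_simps)
  then show "(turan_density q + \<delta>) * card B \<le> degree_in G B x"
    using lower by (simp add: turan_density_def algebra_simps)
qed

lemma almost_full_subset_has_multipartite:
  fixes \<delta> :: real
  assumes r: "2 \<le> r" and delta: "0 < \<delta>"
  shows "\<forall>\<^sub>F n in sequentially. \<forall>(G :: 'a graph) A B. finite A \<longrightarrow> card A = n \<longrightarrow>
    min_degree_ratio_ge G A (turan_density r - \<delta>) \<longrightarrow>
    B \<subseteq> A \<longrightarrow> (turan_density r + 2 * real r * \<delta>) * card A \<le> card B \<longrightarrow> has_multipartite G r t B"
proof -
  obtain q where q: "r = Suc q" "1 \<le> q"
    using r by (cases r) auto
  from min_degree_has_multipartite[OF q(2) delta, of t]
  obtain n1 where n1: "\<And>(G :: 'a graph) A. finite A \<Longrightarrow> n1 \<le> card A \<Longrightarrow>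
      min_degree_ratio_ge G A (turan_density q + \<delta>) \<Longrightarrow> has_multipartite G r t A"
    unfolding eventually_sequentially q(1) by blast
  have "\<forall>\<^sub>F n in sequentially. real n1 < 1 / 2 * n"
    by (rule eventually_less_mult_of_nat) simp
  then show ?thesis
  proof (eventually_elim, intro allI impI)
    fix n and G :: "'a graph" and A B
    assume n: "real n1 < 1 / 2 * n" and A: "finite A" "card A = n"
      and deg: "min_degree_ratio_ge G A (turan_density r - \<delta>)"
      and B: "B \<subseteq> A" "(turan_density r + 2 * real r * \<delta>) * card A \<le> card B"
    have "1 / 2 * real n \<le> (turan_density r + 2 * real r * \<delta>) * n"
      using turan_density_ge_half[OF r] delta
      by (intro mult_right_mono) (auto intro: add_increasing2)
    then have "n1 \<le> card B"
      using n B(2) unfolding A(2) by linarith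
    moreover have "(turan_density r + 2 * real q * \<delta>) * card A \<le>
      (turan_density r + 2 * real r * \<delta>) * card A"
      using q(1) delta by (intro mult_right_mono) auto
    then have "min_degree_ratio_ge G B (turan_density q + \<delta>)"
      using deg B unfolding q(1)
      by (intro min_degree_ratio_ge_almost_full_subset[OF q(2) delta A(1)]) auto
    ultimately show "has_multipartite G r t B"
      using A(1) B(1) finite_subset by (intro n1) auto
  qed
qed

lemma card_nbrs_in_almost_full_subset:
  fixes \<gamma> :: real
  assumes V: "finite V" and A: "A \<subseteq> V" "(1 - \<gamma>) * card V \<le> card A"
    and Z: "finite Z" "card Z \<le> \<gamma> * card V"
  shows "degree_in G V v - 2 * \<gamma> * card V \<le> card (nbrs G v \<inter> A - Z)"
proof -
  have finA: "finite A" and AV: "card A \<le> card V"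
    using A(1) V finite_subset card_mono by blast+
  have "nbrs G v \<inter> V \<subseteq> (nbrs G v \<inter> A - Z) \<union> (Z \<union> (V - A))"
    by auto
  then have "degree_in G V v \<le> card ((nbrs G v \<inter> A - Z) \<union> (Z \<union> (V - A)))"
    using finA Z(1) V by (intro card_mono) auto
  also have "\<dots> \<le> card (nbrs G v \<inter> A - Z) + (card Z + card (V - A))"
    by (meson add_left_mono card_Un_le le_trans)
  finally have "degree_in G V v \<le> card (nbrs G v \<inter> A - Z) + (card Z + card (V - A))" .
  moreover have "real (card (V - A)) = real (card V) - card A"
    using A(1) finA AV by (simp add: card_Diff_subset of_nat_diff)
  ultimately show ?thesis
    using A(2) Z(2) by (simp add: algebra_simps)
qed

lemma almost_regular_high_degree_nbrs:
  fixes \<gamma> :: real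
  assumes r: "2 \<le> r" and gamma: "0 < \<gamma>" "\<gamma> \<le> 1 / 2"
  shows "\<forall>\<^sub>F n in sequentially. \<forall>(G :: 'a graph) V A v Z. finite V \<longrightarrow> card V = n \<longrightarrow> A \<subseteq> V \<longrightarrow>
    (1 - \<gamma>) * card V \<le> card A \<longrightarrow> min_degree_ratio_ge G A (turan_density r - \<gamma>) \<longrightarrow>
    (turan_density r + (2 * real r + 2) * \<gamma>) * card V \<le> degree_in G V v \<longrightarrow> finite Z \<longrightarrow> card Z \<le> K \<longrightarrow>
    has_multipartite G r t (nbrs G v \<inter> V - Z)"
proof -
  define p where "p = turan_density r"
  from almost_full_subset_has_multipartite[OF r gamma(1), of t, where 'a = 'a]
  obtain n1 where n1: "\<forall>n\<ge>n1. \<forall>(G :: 'a graph) A B. finite A \<longrightarrow> card A = n \<longrightarrow>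
      min_degree_ratio_ge G A (p - \<gamma>) \<longrightarrow> B \<subseteq> A \<longrightarrow>
      (p + 2 * real r * \<gamma>) * card A \<le> card B \<longrightarrow> has_multipartite G r t B"
    unfolding eventually_sequentially p_def by blast
  have "\<forall>\<^sub>F n in sequentially. real n1 < 1 / 2 * n" "\<forall>\<^sub>F n in sequentially. real K < \<gamma> * n"
    by (rule eventually_less_mult_of_nat; use gamma(1) in simp)+
  then show ?thesis
    unfolding p_def[symmetric]
  proof (eventually_elim, intro allI impI)
    fix n and G :: "'a graph" and V A v and Z :: "'a set"
    assume n: "real n1 < 1 / 2 * n" "real K < \<gamma> * n" and V: "finite V" "card V = n"
      and A: "A \<subseteq> V" "(1 - \<gamma>) * card V \<le> card A" "min_degree_ratio_ge G A (p - \<gamma>)"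
      and v: "(p + (2 * real r + 2) * \<gamma>) * card V \<le> degree_in G V v" and Z: "finite Z" "card Z \<le> K"
    have "degree_in G V v - 2 * \<gamma> * card V \<le> card (nbrs G v \<inter> A - Z)"
      using Z n(2) V(2) by (intro card_nbrs_in_almost_full_subset[OF V(1) A(1,2)]) auto
    then have "(p + 2 * real r * \<gamma>) * card V \<le> card (nbrs G v \<inter> A - Z)"
      using v by (simp add: algebra_simps)
    moreover have "(p + 2 * real r * \<gamma>) * card A \<le> (p + 2 * real r * \<gamma>) * card V"
      using A(1) V(1) turan_density_ge_half[OF r] gamma(1)
      by (intro mult_left_mono) (auto simp: p_def card_mono)
    moreover have "1 / 2 * real n \<le> (1 - \<gamma>) * card V"
      using gamma(2) V(2) by (intro mult_mono) auto
    then have "n1 \<le> card A"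
      using n(1) A(2) by linarith
    moreover have "nbrs G v \<inter> A - Z \<subseteq> A" "finite A"
      using A(1) V(1) finite_subset by auto
    ultimately have "has_multipartite G r t (nbrs G v \<inter> A - Z)"
      using n1 A(3) order_trans by blast
    then show "has_multipartite G r t (nbrs G v \<inter> V - Z)"
      using A(1) by (elim has_multipartite_mono) auto
  qed
qed

lemma near_extremal_high_degree_nbrs:
  fixes \<epsilon> :: real
  assumes r: "2 \<le> r" and eps: "0 < \<epsilon>" "\<epsilon> \<le> 1"
  obtains \<delta> where "0 < \<delta>"
    "\<forall>\<^sub>F n in sequentially. \<forall>(G :: 'a graph) V v Z. near_extremal r T \<delta> G V \<longrightarrow> card V = n \<longrightarrow>
      (turan_density r + \<epsilon>) * card V \<le> degree_in G V v \<longrightarrow> finite Z \<longrightarrow> card Z \<le> K \<longrightarrow>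
      has_multipartite G r t (nbrs G v \<inter> V - Z)"
proof -
  define \<gamma> where "\<gamma> = \<epsilon> / (2 * real r + 2)"
  have "0 < 2 * real r + 2"
    by simp
  then have gamma: "0 < \<gamma>" "\<gamma> \<le> 1 / 2" "\<epsilon> = (2 * real r + 2) * \<gamma>"
    using eps unfolding \<gamma>_def by (simp, simp add: pos_divide_le_eq, simp)
  have "1 \<le> r" "\<gamma> \<le> 1"
    using r gamma(2) by auto
  from near_extremal_almost_regular[OF this(1) gamma(1) this(2)]
  obtain \<delta> where "0 < \<delta>" and "\<forall>\<^sub>F n in sequentially. \<forall>(G :: 'a graph) V.
      near_extremal r T \<delta> G V \<longrightarrow> card V = n \<longrightarrow>
      (\<exists>A\<subseteq>V. (1 - \<gamma>) * card V \<le> card A \<and> min_degree_ratio_ge G A (turan_density r - \<gamma>))" .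
  note this(2) almost_regular_high_degree_nbrs[OF r gamma(1,2), of K t, where 'a = 'a,
    folded gamma(3)]
  then have "\<forall>\<^sub>F n in sequentially. \<forall>(G :: 'a graph) V v Z. near_extremal r T \<delta> G V \<longrightarrow> card V = n \<longrightarrow>
      (turan_density r + \<epsilon>) * card V \<le> degree_in G V v \<longrightarrow> finite Z \<longrightarrow> card Z \<le> K \<longrightarrow>
      has_multipartite G r t (nbrs G v \<inter> V - Z)"
  proof (eventually_elim, intro allI impI)
    fix n and G :: "'a graph" and V v and Z :: "'a set"
    assume nbrs: "\<forall>(G :: 'a graph) V A v Z. finite V \<longrightarrow> card V = n \<longrightarrow> A \<subseteq> V \<longrightarrow>
        (1 - \<gamma>) * card V \<le> card A \<longrightarrow> min_degree_ratio_ge G A (turan_density r - \<gamma>) \<longrightarrow>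
        (turan_density r + \<epsilon>) * card V \<le> degree_in G V v \<longrightarrow> finite Z \<longrightarrow> card Z \<le> K \<longrightarrow>
        has_multipartite G r t (nbrs G v \<inter> V - Z)"
      and "\<forall>(G :: 'a graph) V. near_extremal r T \<delta> G V \<longrightarrow> card V = n \<longrightarrow>
        (\<exists>A\<subseteq>V. (1 - \<gamma>) * card V \<le> card A \<and> min_degree_ratio_ge G A (turan_density r - \<gamma>))"
      and G: "near_extremal r T \<delta> G V" "card V = n"
      and v: "(turan_density r + \<epsilon>) * card V \<le> degree_in G V v" "finite Z" "card Z \<le> K"
    then obtain A
      where "A \<subseteq> V" "(1 - \<gamma>) * card V \<le> card A" "min_degree_ratio_ge G A (turan_density r - \<gamma>)"
      by blast
    moreover have "finite V"
      using G(1) by (simp add: near_extremal_def)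
    ultimately show "has_multipartite G r t (nbrs G v \<inter> V - Z)"
      using nbrs G(2) v by blast
  qed
  then show thesis
    using that \<open>0 < \<delta>\<close> by blast
qed

section \<open>Embeddings and isomorphisms\<close>

definition map_graph :: "('a \<Rightarrow> 'b) \<Rightarrow> 'a graph \<Rightarrow> 'b graph" where
  "map_graph f G = \<lparr>verts = f ` verts G, edges = (\<lambda>e. f ` e) ` edges G\<rparr>"

definition embedding :: "('f \<Rightarrow> 'a) \<Rightarrow> 'f graph \<Rightarrow> 'a graph \<Rightarrow> bool" where
  "embedding f F G \<longleftrightarrow> inj_on f (verts F) \<and> f ` verts F \<subseteq> verts G \<and> (\<forall>e\<in>edges F. f ` e \<in> edges G)"

definition induced :: "'a graph \<Rightarrow> 'a set \<Rightarrow> 'a graph" where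
  "induced G A = \<lparr>verts = A, edges = edges_in G A\<rparr>"

lemma inj_on_image_edges: "simple_graph G \<Longrightarrow> inj_on f (verts G) \<Longrightarrow> inj_on (\<lambda>e. f ` e) (edges G)"
  by (rule inj_on_subset[OF inj_on_image_Pow]) (auto simp: simple_graph_def)

lemma simple_graph_map:
  assumes G: "simple_graph G" and f: "inj_on f (verts G)"
  shows "simple_graph (map_graph f G)"
proof -
  have "card (f ` e) = 2" if "e \<in> edges G" for e
    using G that card_image[OF inj_on_subset[OF f]] by (simp add: simple_graph_def)
  then show ?thesis
    using G by (auto simp: simple_graph_def map_graph_def)
qed

lemma graph_iso_map: "inj_on f (verts G) \<Longrightarrow> graph_iso G (map_graph f G)"
  unfolding graph_iso_def map_graph_def by (intro exI[of _ f]) (simp add: bij_betw_imageI)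

lemma graph_iso_sym:
  assumes G: "simple_graph G" and iso: "graph_iso G H"
  shows "graph_iso H G"
proof -
  obtain f where f: "bij_betw f (verts G) (verts H)" "(\<lambda>e. f ` e) ` edges G = edges H"
    using iso by (auto simp: graph_iso_def)
  define g where "g = the_inv_into (verts G) f"
  have inv: "g (f x) = x" if "x \<in> verts G" for x
    using f(1) that by (simp add: g_def bij_betw_def the_inv_into_f_f)
  have "g ` f ` e = e" if "e \<in> edges G" for e
  proof -
    have "e \<subseteq> verts G"
      using G that by (simp add: simple_graph_def)
    then show ?thesis
      using inv by (force simp: image_image)
  qed
  then have "(\<lambda>e. g ` e) ` edges H = edges G"
    unfolding f(2)[symmetric] by (simp add: image_image)
  moreover have "bij_betw g (verts H) (verts G)"
    using f(1) by (simp add: g_def bij_betw_the_inv_into)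
  ultimately show ?thesis
    unfolding graph_iso_def by blast
qed

lemma graph_iso_card_verts: "graph_iso G H \<Longrightarrow> card (verts G) = card (verts H)"
  by (auto simp: graph_iso_def bij_betw_same_card)

lemma graph_iso_card_edges:
  assumes "simple_graph G" "graph_iso G H"
  shows "card (edges G) = card (edges H)"
proof -
  obtain f where "inj_on f (verts G)" "(\<lambda>e. f ` e) ` edges G = edges H"
    using assms(2) by (auto simp: graph_iso_def bij_betw_def)
  then show ?thesis
    using inj_on_image_edges[OF assms(1)] by (metis card_image)
qed

lemma embedding_comp: "embedding f F G \<Longrightarrow> embedding g G H \<Longrightarrow> embedding (g \<circ> f) F H"
  unfolding embedding_def
  by (auto simp del: o_apply simp: image_comp[symmetric] intro!: comp_inj_on intro: inj_on_subset)

lemma embedding_if_graph_iso: "graph_iso G H \<Longrightarrow> \<exists>f. embedding f G H"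
  by (force simp: graph_iso_def embedding_def bij_betw_def)

lemma embedding_subgraph: "subgraph S G \<Longrightarrow> embedding id S G"
  by (simp add: subgraph_def embedding_def subset_iff)

lemma subgraph_map_graph: "simple_graph F \<Longrightarrow> embedding f F G \<Longrightarrow> subgraph (map_graph f F) G"
  using simple_graph_map[of F f] by (auto simp: subgraph_def embedding_def map_graph_def)

lemma graph_free_iff_no_embedding:
  assumes F: "simple_graph F"
  shows "graph_free F G \<longleftrightarrow> (\<nexists>f. embedding f F G)"
proof
  assume "graph_free F G"
  then show "\<nexists>f. embedding f F G"
    using subgraph_map_graph[OF F] graph_iso_sym[OF F graph_iso_map]
    unfolding graph_free_def embedding_def by blast
next
  assume free: "\<nexists>f. embedding f F G"
  have False if S: "subgraph S G" "graph_iso S F" for S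
  proof -
    have "simple_graph S"
      using S(1) by (simp add: subgraph_def)
    then obtain f where "embedding f F S"
      using S(2) graph_iso_sym embedding_if_graph_iso by blast
    then show False
      using free embedding_comp embedding_subgraph[OF S(1)] by blast
  qed
  then show "graph_free F G"
    unfolding graph_free_def by blast
qed

lemma graph_free_iso:
  assumes "simple_graph F" "simple_graph G" "graph_iso G H" "graph_free F G"
  shows "graph_free F H"
proof -
  obtain g where "embedding g H G"
    using assms(2,3) graph_iso_sym embedding_if_graph_iso by blast
  then show ?thesis
    using assms(4) embedding_comp unfolding graph_free_iff_no_embedding[OF assms(1)] by blast
qed

lemma simple_graph_induced: "simple_graph G \<Longrightarrow> finite A \<Longrightarrow> simple_graph (induced G A)"
  by (auto simp: simple_graph_def induced_def edges_in_def)

lemma embedding_induced_iff: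
  assumes "simple_graph F" "A \<subseteq> verts G"
  shows "embedding f F (induced G A) \<longleftrightarrow> embedding f F G \<and> f ` verts F \<subseteq> A"
  using assms by (auto simp: embedding_def induced_def edges_in_def simple_graph_def) blast

lemma graph_free_induced_iff:
  assumes "simple_graph F" "A \<subseteq> verts G"
  shows "graph_free F (induced G A) \<longleftrightarrow> (\<nexists>f. embedding f F G \<and> f ` verts F \<subseteq> A)"
  by (simp add: graph_free_iff_no_embedding[OF assms(1)] embedding_induced_iff[OF assms])

section \<open>Colourings and critical vertices\<close>

lemma chromatic_number_colouring:
  assumes F: "simple_graph F"
  shows "\<exists>c. proper_colouring F (chromatic_number F) c"
proof -
  obtain c :: "'a \<Rightarrow> nat" where numbering: "bij_betw c (verts F) {0..<card (verts F)}"
    using ex_bij_betw_finite_nat[OF finite_verts[OF F]] ..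
  have "proper_colouring F (card (verts F)) c"
    unfolding proper_colouring_def
  proof (intro conjI allI impI)
    show "c ` verts F \<subseteq> {..<card (verts F)}"
      using numbering by (auto simp: bij_betw_def)
    fix u v
    assume "{u, v} \<in> edges F"
    then have "u \<noteq> v" "u \<in> verts F" "v \<in> verts F"
      using F by (auto simp: simple_graph_def)
    then show "c u \<noteq> c v"
      using numbering by (auto simp: bij_betw_def inj_on_def)
  qed
  then have "\<exists>k c. proper_colouring F k c"
    by blast
  then show ?thesis
    unfolding chromatic_number_def by (rule LeastI_ex)
qed

lemma chromatic_number_le: "proper_colouring F k c \<Longrightarrow> chromatic_number F \<le> k"
  unfolding chromatic_number_def by (rule Least_le) blast

lemma proper_colouring_vertex_extension:
  assumes F: "simple_graph F" and colouring: "proper_colouring (delete_vertex F u) r c"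
  shows "proper_colouring F (Suc r) (c(u := r))"
  unfolding proper_colouring_def
proof (intro conjI allI impI)
  have less: "c x < r" if "x \<in> verts F" "x \<noteq> u" for x
    using colouring that by (auto simp: proper_colouring_def delete_vertex_def)
  show "(c(u := r)) ` verts F \<subseteq> {..<Suc r}"
    using less less_Suc_eq by auto
  fix x y
  assume xy: "{x, y} \<in> edges F"
  then have ends: "x \<noteq> y" "x \<in> verts F" "y \<in> verts F"
    using F by (auto simp: simple_graph_def)
  show "(c(u := r)) x \<noteq> (c(u := r)) y"
  proof (cases "x = u \<or> y = u")
    case True
    then show ?thesis
      using ends less by fastforce
  next
    case False
    then have "{x, y} \<in> edges (delete_vertex F u)"
      using xy by (auto simp: delete_vertex_def)
    then show ?thesis
      using colouring False by (auto simp: proper_colouring_def)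
  qed
qed

lemma vertex_critical_colouring:
  assumes F: "simple_graph F" "vertex_critical F" "chromatic_number F = Suc r"
  obtains u c where "proper_colouring F (Suc r) c" "{x \<in> verts F. c x = r} = {u}"
proof -
  obtain u where u: "u \<in> verts F" "chromatic_number (delete_vertex F u) = r"
    using F by (auto simp: vertex_critical_def)
  have "simple_graph (delete_vertex F u)"
    using F(1) by (auto simp: simple_graph_def delete_vertex_def)
  then obtain c where colouring: "proper_colouring (delete_vertex F u) r c"
    using chromatic_number_colouring u(2) by blast
  then have "c x < r" if "x \<in> verts F" "x \<noteq> u" for x
    using that by (auto simp: proper_colouring_def delete_vertex_def)
  then have "{x \<in> verts F. (c(u := r)) x = r} = {u}"
    using u(1) by (auto simp: less_le)
  then show thesis
    using that proper_colouring_vertex_extension[OF F(1) colouring] by blast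
qed

lemma embedding_colour_classes:
  assumes F: "simple_graph F" and colouring: "proper_colouring F q c" and G: "simple_graph G"
    and S: "multipartite_in G q S A" and A: "A \<subseteq> verts G"
    and card: "\<And>i. i < q \<Longrightarrow> card {x \<in> verts F. c x = i} \<le> card (S i)"
  shows "\<exists>f. embedding f F G \<and> f ` verts F \<subseteq> A"
proof -
  have SA: "S i \<subseteq> A" if "i < q" for i
    using S that by (simp add: multipartite_in_def)
  have "\<exists>g. g ` {x \<in> verts F. c x = i} \<subseteq> S i \<and> inj_on g {x \<in> verts F. c x = i}" if "i < q" for i
    using finite_verts[OF F] finite_subset[OF subset_trans[OF SA[OF that] A] finite_verts[OF G]]
      card[OF that]
    by (intro card_le_inj) auto
  then obtain g where g: "\<And>i. i < q \<Longrightarrow> g i ` {x \<in> verts F. c x = i} \<subseteq> S i \<and>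
      inj_on (g i) {x \<in> verts F. c x = i}"
    by metis
  define f where "f x = g (c x) x" for x
  have cq: "c x < q" if "x \<in> verts F" for x
    using colouring that by (auto simp: proper_colouring_def)
  have fS: "f x \<in> S (c x)" if "x \<in> verts F" for x
    using g[OF cq[OF that]] that by (auto simp: f_def)
  have adj: "{f x, f y} \<in> edges G" if "x \<in> verts F" "y \<in> verts F" "c x \<noteq> c y" for x y
    using S fS cq that unfolding multipartite_in_def by blast
  have "inj_on f (verts F)"
  proof (rule inj_onI)
    fix x y
    assume xy: "x \<in> verts F" "y \<in> verts F" "f x = f y"
    have "{f x, f x} \<notin> edges G"
      using G by (auto simp: simple_graph_def)
    then have "c x = c y"
      using adj[of x y] xy by auto
    then show "x = y"
      using xy g[OF cq[OF xy(1)]] by (auto simp: f_def inj_on_def)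
  qed
  moreover have "f ` verts F \<subseteq> A"
    using fS cq SA by blast
  moreover have "f ` e \<in> edges G" if e: "e \<in> edges F" for e
  proof -
    obtain x y where xy: "e = {x, y}" "x \<in> verts F" "y \<in> verts F"
      using F e by (rule simple_graph_edgeE)
    then have "c x \<noteq> c y"
      using colouring e by (auto simp: proper_colouring_def)
    then show ?thesis
      using adj xy by simp
  qed
  ultimately show ?thesis
    using A by (auto simp: embedding_def)
qed

lemma card_colour_class_le: "simple_graph F \<Longrightarrow> card {x \<in> verts F. c x = i} \<le> card (verts F)"
  by (simp add: card_mono finite_verts)

lemma has_multipartite_embedding:
  assumes F: "simple_graph F" "proper_colouring F q c" "card (verts F) \<le> t"
    and G: "simple_graph G" "has_multipartite G q t (verts G)"
  shows "\<exists>f. embedding f F G"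
proof -
  obtain S where S: "multipartite_in G q S (verts G)" "\<And>i. i < q \<Longrightarrow> card (S i) = t"
    using G(2) unfolding has_multipartite_def by blast
  have "card {x \<in> verts F. c x = i} \<le> card (S i)" if "i < q" for i
    unfolding S(2)[OF that] using card_colour_class_le[OF F(1)] F(3) by (rule le_trans)
  then show ?thesis
    using embedding_colour_classes[OF F(1,2) G(1) S(1) order_refl] by blast
qed

lemma vertex_critical_embedding:
  assumes F: "simple_graph F" "vertex_critical F" "chromatic_number F = Suc r" "card (verts F) \<le> t"
    and G: "simple_graph G" "v \<in> verts G"
    and multipartite: "has_multipartite G r t (nbrs G v \<inter> verts G - Z)"
  shows "\<exists>f. embedding f F G \<and> f ` verts F \<subseteq> insert v (verts G - Z)"
proof -
  obtain S where S: "multipartite_in G r S (nbrs G v \<inter> verts G - Z)" "\<And>i. i < r \<Longrightarrow> card (S i) = t"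
    using multipartite unfolding has_multipartite_def by blast
  have nbr: "S i \<subseteq> nbrs G v \<inter> verts G - Z" if "i < r" for i
    using S(1) that by (simp add: multipartite_in_def)
  obtain u c where colouring: "proper_colouring F (Suc r) c" "{x \<in> verts F. c x = r} = {u}"
    using vertex_critical_colouring[OF F(1-3)] .
  have "multipartite_in G r S (insert v (verts G - Z))"
    using nbr by (intro multipartite_in_mono[OF S(1)]) blast
  then have "multipartite_in G (Suc r) (S(r := {v})) (insert v (verts G - Z))"
  proof (rule multipartite_in_fun_upd)
    show "{x, y} \<in> edges G" if "i < r" "x \<in> S i" "y \<in> {v}" for i x y
    proof -
      have "x \<in> nbrs G v"
        using nbr that by blast
      then show ?thesis
        using that(3) by (simp add: nbrs_def insert_commute)
    qed
  qed simp
  moreover have "card {x \<in> verts F. c x = i} \<le> card ((S(r := {v})) i)" if "i < Suc r" for i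
  proof (cases "i = r")
    case False
    then show ?thesis
      using that S(2) card_colour_class_le[OF F(1), of c i] F(4) by simp
  qed (simp add: colouring(2))
  ultimately show ?thesis
    using G(2) by (intro embedding_colour_classes[OF F(1) colouring(1) G(1)]) auto
qed

section \<open>Extremal numbers\<close>

lemma nat_copy:
  fixes G :: "'a graph"
  assumes G: "simple_graph G"
  obtains H :: "nat graph" where "simple_graph H" "graph_iso G H"
proof -
  obtain c :: "'a \<Rightarrow> nat" where "inj_on c (verts G)"
    using finite_imp_inj_to_nat_seg[OF finite_verts[OF G]] by blast
  then show thesis
    using that simple_graph_map[OF G] graph_iso_map by blast
qed

lemma finite_edge_counts:
  "finite {card (edges G) | G :: nat graph. simple_graph G \<and> card (verts G) = n \<and> graph_free F G}"
proof (rule finite_subset)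
  show "{card (edges G) | G :: nat graph. simple_graph G \<and> card (verts G) = n \<and>
    graph_free F G} \<subseteq> {..n\<^sup>2}"
  proof clarsimp
    fix G :: "nat graph"
    assume G: "simple_graph G" "n = card (verts G)"
    then show "card (edges G) \<le> (card (verts G))\<^sup>2"
      using card_edges_in_le_square[OF G(1) finite_verts[OF G(1)]] by (simp add: edges_in_verts)
  qed
qed simp

lemma card_edges_le_ex_number:
  assumes "simple_graph F" "simple_graph G" "graph_free F G"
  shows "card (edges G) \<le> ex_number (card (verts G)) F"
proof -
  obtain H :: "nat graph" where H: "simple_graph H" "graph_iso G H"
    using nat_copy[OF assms(2)] .
  then have "graph_free F H" "card (verts H) = card (verts G)" "card (edges H) = card (edges G)"
    using assms graph_free_iso graph_iso_card_verts graph_iso_card_edges by metis+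
  then show ?thesis
    using H(1) unfolding ex_number_def by (intro Max_ge finite_edge_counts) force
qed

lemma extremal_graphs_nonempty:
  assumes "simple_graph F" "simple_graph G" "graph_free F G"
  obtains H :: "nat graph" where "H \<in> extremal_graphs (card (verts G)) F"
proof -
  let ?counts = "{card (edges H) | H :: nat graph. simple_graph H \<and>
    card (verts H) = card (verts G) \<and> graph_free F H}"
  obtain H :: "nat graph" where H: "simple_graph H" "graph_iso G H"
    using nat_copy[OF assms(2)] .
  have "card (verts H) = card (verts G)" "graph_free F H"
    using H(2) assms graph_free_iso by (auto simp: graph_iso_card_verts)
  then have "?counts \<noteq> {}"
    using H(1) by blast
  then have "Max ?counts \<in> ?counts"
    using finite_edge_counts by (rule Max_in[rotated])
  then obtain H :: "nat graph"
    where "simple_graph H" "card (verts H) = card (verts G)" "graph_free F H"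
    "card (edges H) = Max ?counts"
    by (auto simp del: Max_in)
  then show thesis
    using that[of H] by (simp add: extremal_graphs_def ex_number_def)
qed

definition turan_graph :: "nat \<Rightarrow> nat \<Rightarrow> nat graph" where
  "turan_graph r n = \<lparr>verts = {..<n}, edges = {{u, v} | u v. u < n \<and> v < n \<and> u mod r \<noteq> v mod r}\<rparr>"

lemma simple_turan_graph: "simple_graph (turan_graph r n)"
  by (auto simp: simple_graph_def turan_graph_def card_2_iff)

lemma turan_graph_free:
  assumes F: "simple_graph F" "chromatic_number F = Suc r" and r: "0 < r"
  shows "graph_free F (turan_graph r n)"
  unfolding graph_free_iff_no_embedding[OF F(1)]
proof clarify
  fix f
  assume f: "embedding f F (turan_graph r n)"
  have "proper_colouring F r (\<lambda>x. f x mod r)"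
    unfolding proper_colouring_def
  proof (intro conjI allI impI)
    show "(\<lambda>x. f x mod r) ` verts F \<subseteq> {..<r}"
      using r by auto
    fix x y
    assume "{x, y} \<in> edges F"
    then have "f ` {x, y} \<in> edges (turan_graph r n)"
      using f unfolding embedding_def by blast
    then obtain a b where "{f x, f y} = {a, b}" "a mod r \<noteq> b mod r"
      by (auto simp: turan_graph_def)
    then show "f x mod r \<noteq> f y mod r"
      by (metis doubleton_eq_iff)
  qed
  then show False
    using chromatic_number_le F(2) by fastforce
qed

lemma card_same_residue_less:
  assumes "0 < r"
  shows "card {v. v < n \<and> v mod r = n mod r} \<le> (n :: nat) div r"
proof -
  let ?B = "{v. v < n \<and> v mod r = n mod r}"
  have "v div r < n div r" if v: "v \<in> ?B" for v
  proof -
    have "v < n" "v mod r = n mod r"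
      using v by auto
    then have "v div r \<noteq> n div r"
      by (metis div_mult_mod_eq less_irrefl)
    moreover have "v div r \<le> n div r"
      using \<open>v < n\<close> by (simp add: div_le_mono)
    ultimately show ?thesis
      by simp
  qed
  moreover have "inj_on (\<lambda>v. v div r) ?B"
    by (intro inj_onI) (metis (mono_tags, lifting) div_mult_mod_eq mem_Collect_eq)
  ultimately have "card ?B \<le> card {..<n div r}"
    by (intro card_inj_on_le) auto
  then show ?thesis
    by simp
qed

lemma degree_turan_graph_last:
  assumes r: "0 < r"
  shows "turan_density r * n \<le> degree_in (turan_graph r (Suc n)) {..<Suc n} n"
proof -
  let ?T = "turan_graph r (Suc n)" and ?B = "{v. v < n \<and> v mod r = n mod r}"
  have "v \<in> nbrs ?T n \<inter> {..<Suc n}" if "v \<in> {..<n} - ?B" for v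
  proof -
    have "{n, v} = {n, v} \<and> n < Suc n \<and> v < Suc n \<and> n mod r \<noteq> v mod r"
      using that by auto
    then show ?thesis
      unfolding nbrs_def turan_graph_def by simp blast
  qed
  then have "card ({..<n} - ?B) \<le> degree_in ?T {..<Suc n} n"
    by (intro card_mono) auto
  moreover have "n - card ?B \<le> card ({..<n} - ?B)"
    using diff_card_le_card_Diff[of ?B "{..<n}"] by simp
  moreover have "card ?B \<le> n / r"
    using card_same_residue_less[OF r, of n] of_nat_div_le_of_nat[of n r, where 'a = real]
    by linarith
  ultimately show ?thesis
    by (simp add: turan_density_def algebra_simps)
qed

lemma card_edges_turan_graph:
  assumes r: "0 < r"
  shows "turan_density r * (real n * (real n - 1)) / 2 \<le> card (edges (turan_graph r n))"
proof (induction n)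
  case 0
  then show ?case
    by simp
next
  case (Suc n)
  let ?T = "turan_graph r (Suc n)"
  have "edges_in ?T ({..<Suc n} - {n}) = edges (turan_graph r n)"
    by (fastforce simp: edges_in_def turan_graph_def less_Suc_eq)
  then have "card (edges ?T) = card (edges (turan_graph r n)) + degree_in ?T {..<Suc n} n"
    using card_edges_in_remove[OF simple_turan_graph, of "{..<Suc n}" n r "Suc n"]
      edges_in_verts[OF simple_turan_graph[of r "Suc n"]] by (simp add: turan_graph_def)
  moreover have "turan_density r * (real (Suc n) * (real (Suc n) - 1)) / 2 =
      turan_density r * (real n * (real n - 1)) / 2 + turan_density r * n"
    by (simp add: algebra_simps add_divide_distrib diff_divide_distrib)
  ultimately show ?case
    using Suc.IH degree_turan_graph_last[OF r, of n] by linarith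
qed

lemma exists_extremal_graph:
  assumes "simple_graph F" "chromatic_number F = Suc r" "0 < r"
  obtains G :: "nat graph" where "G \<in> extremal_graphs n F"
  using extremal_graphs_nonempty[OF assms(1) simple_turan_graph turan_graph_free[OF assms], of n]
  by (auto simp: turan_graph_def)

lemma eventually_ex_number_ge_density:
  fixes \<delta> :: real
  assumes F: "simple_graph F" "chromatic_number F = Suc r" "0 < r" and delta: "0 < \<delta>"
  shows "\<forall>\<^sub>F n in sequentially. (turan_density r - \<delta>) * n\<^sup>2 / 2 \<le> ex_number n F"
proof -
  have "\<forall>\<^sub>F n in sequentially. 1 < \<delta> * n"
    using delta by (rule eventually_less_mult_of_nat)
  then show ?thesis
  proof eventually_elim
    case (elim n)
    have "turan_density r * real n \<le> 1 * real n"
      by (intro mult_right_mono turan_density_le_one) simp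
    also have "\<dots> \<le> (\<delta> * n) * n"
      using elim by (intro mult_right_mono) auto
    finally have "(turan_density r - \<delta>) * (real n)\<^sup>2 / 2 \<le>
      turan_density r * (real n * (real n - 1)) / 2"
      by (simp add: power2_eq_square algebra_simps diff_divide_distrib)
    also have "\<dots> \<le> card (edges (turan_graph r n))"
      using F(3) by (rule card_edges_turan_graph)
    also have "card (edges (turan_graph r n)) \<le> ex_number n F"
      using card_edges_le_ex_number[OF F(1) simple_turan_graph turan_graph_free[OF F]]
      by (simp add: turan_graph_def)
    finally show ?case
      by simp
  qed
qed

section \<open>Growth of the extremal number\<close>

lemma degree_in_almost_full_subset:
  fixes p \<gamma> :: real
  assumes V: "finite V" and A: "A \<subseteq> V" "(1 - \<gamma>) * card V \<le> card A"
    and p: "\<gamma> \<le> p" "p \<le> 1" "0 \<le> \<gamma>" and deg: "min_degree_ratio_ge G A (p - \<gamma>)" "s \<in> A"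
  shows "(p - 2 * \<gamma>) * card V \<le> degree_in G V s"
proof -
  have "p * \<gamma> \<le> \<gamma>" "0 \<le> \<gamma> * \<gamma>"
    using p by (simp_all add: mult_left_le_one_le)
  moreover have "(p - \<gamma>) * (1 - \<gamma>) = p - \<gamma> - p * \<gamma> + \<gamma> * \<gamma>"
    by (simp add: algebra_simps)
  ultimately have "p - 2 * \<gamma> \<le> (p - \<gamma>) * (1 - \<gamma>)"
    by linarith
  then have "(p - 2 * \<gamma>) * card V \<le> (p - \<gamma>) * ((1 - \<gamma>) * card V)"
    by (simp add: mult_right_mono flip: mult.assoc)
  also have "\<dots> \<le> (p - \<gamma>) * card A"
    using A(2) p(1) by (intro mult_left_mono) auto
  also have "\<dots> \<le> degree_in G A s"
    using deg by (simp add: min_degree_ratio_ge_def)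
  also have "degree_in G A s \<le> degree_in G V s"
    using A(1) V by (intro card_mono) auto
  finally show ?thesis
    by simp
qed

lemma almost_regular_has_multipartite:
  fixes \<gamma> :: real
  assumes r: "2 \<le> r" and gamma: "0 < \<gamma>" "\<gamma> \<le> 1 / (2 * (real r)\<^sup>2)"
  shows "\<forall>\<^sub>F n in sequentially. \<forall>(G :: 'a graph) A. finite A \<longrightarrow> card A = n \<longrightarrow>
    min_degree_ratio_ge G A (turan_density r - \<gamma>) \<longrightarrow> has_multipartite G r t A"
proof -
  have "turan_density r + 2 * real r * \<gamma> \<le> turan_density r + 2 * real r * (1 / (2 * (real r)\<^sup>2))"
    using gamma(2) by (intro add_left_mono mult_left_mono) auto
  also have "\<dots> = 1"
    using r by (simp add: turan_density_def power2_eq_square)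
  finally have "(turan_density r + 2 * real r * \<gamma>) * m \<le> m" if "0 \<le> m" for m
    using mult_right_mono[OF _ that] by fastforce
  then show ?thesis
    using almost_full_subset_has_multipartite[OF r gamma(1), of t, where 'a = 'a]
    by (auto elim!: eventually_mono)
qed

definition high_degree_classes :: "'a graph \<Rightarrow> nat \<Rightarrow> nat \<Rightarrow> real \<Rightarrow> 'a set \<Rightarrow> (nat \<Rightarrow> 'a set) \<Rightarrow> bool"
  where
  "high_degree_classes G r M p V S \<longleftrightarrow> multipartite_in G r S V \<and>
     (\<forall>i<r. card (S i) = M \<and> (\<forall>s\<in>S i. p * card V \<le> degree_in G V s))"

lemma almost_regular_high_degree_classes:
  fixes \<gamma> :: real
  assumes r: "2 \<le> r" and gamma: "0 < \<gamma>" "\<gamma> \<le> 1 / (2 * (real r)\<^sup>2)" "\<gamma> \<le> 1 / 2"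
  shows "\<forall>\<^sub>F n in sequentially. \<forall>(G :: 'a graph) V A. finite V \<longrightarrow> card V = n \<longrightarrow> A \<subseteq> V \<longrightarrow>
    (1 - \<gamma>) * card V \<le> card A \<longrightarrow> min_degree_ratio_ge G A (turan_density r - \<gamma>) \<longrightarrow>
    (\<exists>S. high_degree_classes G r M (turan_density r - 2 * \<gamma>) V S)"
proof -
  from almost_regular_has_multipartite[OF r gamma(1,2), of M, where 'a = 'a]
  obtain n1 where n1: "\<And>(G :: 'a graph) A. finite A \<Longrightarrow> n1 \<le> card A \<Longrightarrow>
      min_degree_ratio_ge G A (turan_density r - \<gamma>) \<Longrightarrow> has_multipartite G r M A"
    unfolding eventually_sequentially by blast
  have "\<forall>\<^sub>F n in sequentially. real n1 < 1 / 2 * n"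
    by (rule eventually_less_mult_of_nat) simp
  then show ?thesis
  proof (eventually_elim, intro allI impI)
    fix n and G :: "'a graph" and V A
    assume n: "real n1 < 1 / 2 * n" and V: "finite V" "card V = n"
      and A: "A \<subseteq> V" "(1 - \<gamma>) * card V \<le> card A" "min_degree_ratio_ge G A (turan_density r - \<gamma>)"
    have "1 / 2 * real n \<le> (1 - \<gamma>) * card V"
      using gamma(3) V(2) by (intro mult_mono) auto
    then have "n1 \<le> card A"
      using n A(2) by linarith
    then obtain S where S: "multipartite_in G r S A" "\<forall>i<r. card (S i) = M"
      using n1 A(1,3) V(1) finite_subset unfolding has_multipartite_def by metis
    have "(turan_density r - 2 * \<gamma>) * card V \<le> degree_in G V s" if "s \<in> A" for s
      using turan_density_ge_half[OF r] turan_density_le_one[of r] gamma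
      by (intro degree_in_almost_full_subset[OF V(1) A(1,2) _ _ _ A(3) that]) auto
    then show "\<exists>S. high_degree_classes G r M (turan_density r - 2 * \<gamma>) V S"
      using S A(1) unfolding high_degree_classes_def multipartite_in_def
      by (intro exI[of _ S]) blast
  qed
qed

lemma high_degree_classes_mono:
  assumes "high_degree_classes G r M p V S" "q \<le> p"
  shows "high_degree_classes G r M q V S"
proof -
  have "q * card V \<le> p * card V"
    using assms(2) by (intro mult_right_mono) auto
  then show ?thesis
    using assms(1) order_trans unfolding high_degree_classes_def by blast
qed

lemma near_extremal_high_degree_classes:
  fixes \<beta> :: real
  assumes r: "2 \<le> r" and beta: "0 < \<beta>"
  obtains \<delta> where "0 < \<delta>"
    "\<forall>\<^sub>F n in sequentially. \<forall>(G :: 'a graph) V. near_extremal r t \<delta> G V \<longrightarrow> card V = n \<longrightarrow>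
      (\<exists>S. high_degree_classes G r M (turan_density r - \<beta>) V S)"
proof -
  define \<gamma> where "\<gamma> = min (\<beta> / 2) (min (1 / (2 * (real r)\<^sup>2)) (1 / 2))"
  have gamma: "0 < \<gamma>" "\<gamma> \<le> \<beta> / 2" "\<gamma> \<le> 1 / (2 * (real r)\<^sup>2)" "\<gamma> \<le> 1 / 2"
    using beta r unfolding \<gamma>_def by (simp, linarith+)
  then have "1 \<le> r" "\<gamma> \<le> 1"
    using r by auto
  from near_extremal_almost_regular[OF this(1) gamma(1) this(2)]
  obtain \<delta> where "0 < \<delta>" and "\<forall>\<^sub>F n in sequentially. \<forall>(G :: 'a graph) V.
      near_extremal r t \<delta> G V \<longrightarrow> card V = n \<longrightarrow>
      (\<exists>A\<subseteq>V. (1 - \<gamma>) * card V \<le> card A \<and> min_degree_ratio_ge G A (turan_density r - \<gamma>))" .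
  note this(2) almost_regular_high_degree_classes[OF r gamma(1,3,4), of M, where 'a = 'a]
  then have "\<forall>\<^sub>F n in sequentially. \<forall>(G :: 'a graph) V. near_extremal r t \<delta> G V \<longrightarrow> card V = n \<longrightarrow>
      (\<exists>S. high_degree_classes G r M (turan_density r - \<beta>) V S)"
  proof (eventually_elim, intro allI impI)
    fix n and G :: "'a graph" and V
    assume classes: "\<forall>(G :: 'a graph) V A. finite V \<longrightarrow> card V = n \<longrightarrow> A \<subseteq> V \<longrightarrow>
        (1 - \<gamma>) * card V \<le> card A \<longrightarrow> min_degree_ratio_ge G A (turan_density r - \<gamma>) \<longrightarrow>
        (\<exists>S. high_degree_classes G r M (turan_density r - 2 * \<gamma>) V S)"
      and "\<forall>(G :: 'a graph) V. near_extremal r t \<delta> G V \<longrightarrow> card V = n \<longrightarrow>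
        (\<exists>A\<subseteq>V. (1 - \<gamma>) * card V \<le> card A \<and> min_degree_ratio_ge G A (turan_density r - \<gamma>))"
      and G: "near_extremal r t \<delta> G V" "card V = n"
    then obtain A
      where "A \<subseteq> V" "(1 - \<gamma>) * card V \<le> card A" "min_degree_ratio_ge G A (turan_density r - \<gamma>)"
      by blast
    moreover have "finite V"
      using G(1) by (simp add: near_extremal_def)
    ultimately obtain S where "high_degree_classes G r M (turan_density r - 2 * \<gamma>) V S"
      using classes G(2) by blast
    then have "high_degree_classes G r M (turan_density r - \<beta>) V S"
      by (rule high_degree_classes_mono) (use gamma(2) in simp)
    then show "\<exists>S. high_degree_classes G r M (turan_density r - \<beta>) V S"
      by blast
  qed
  then show thesis
    using that \<open>0 < \<delta>\<close> by blast
qed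

lemma vertex_critical_free_few_nbrs:
  assumes F: "simple_graph F" "vertex_critical F" "chromatic_number F = Suc r" "card (verts F) \<le> t"
    and G: "simple_graph G" "graph_free F G"
    and S: "multipartite_in G r S (verts G)" and x: "x \<in> verts G"
  shows "\<exists>k<r. degree_in G (S k) x < t"
proof (rule ccontr)
  assume "\<not> ?thesis"
  then have "\<exists>R. R \<subseteq> nbrs G x \<inter> S i \<and> card R = t" if "i < r" for i
    using that by (meson not_less obtain_subset_with_card_n)
  then obtain R where R: "\<And>i. i < r \<Longrightarrow> R i \<subseteq> nbrs G x \<inter> S i \<and> card (R i) = t"
    by metis
  have "R i \<subseteq> S i \<inter> (nbrs G x \<inter> verts G - {})" if "i < r" for i
  proof -
    have "S i \<subseteq> verts G"
      using S that by (simp add: multipartite_in_def)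
    then show ?thesis
      using R[OF that] by blast
  qed
  then have "multipartite_in G r R (nbrs G x \<inter> verts G - {})"
    by (rule multipartite_in_mono[OF S])
  then have "has_multipartite G r t (nbrs G x \<inter> verts G - {})"
    using R unfolding has_multipartite_def by blast
  then show False
    using vertex_critical_embedding[OF F G(1) x] G(2) graph_free_iff_no_embedding[OF F(1)] by blast
qed

lemma sum_degree_in_classes_le:
  fixes \<eta> :: real
  assumes k: "k < r" "degree_in G (S k) x \<le> t" and eta: "0 \<le> \<eta>"
    and degree_le: "\<And>i. i < r \<Longrightarrow> degree_in G (S i) x \<le> M"
  shows "(\<Sum>i<r. real (degree_in G (S i) x)) \<le>
    t + (real r - 1) * ((1 - \<eta>) * M) +
      (\<Sum>i<r. if (1 - \<eta>) * M \<le> degree_in G (S i) x then \<eta> * M else 0)"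
proof -
  define excess where "excess i = (if (1 - \<eta>) * M \<le> degree_in G (S i) x then \<eta> * M else 0)" for i
  have "(\<Sum>i<r. degree_in G (S i) x - excess i) \<le> t + (real (card {..<r}) - 1) * ((1 - \<eta>) * M)"
  proof (rule sum_bounded_above_except[of _ k])
    show "degree_in G (S k) x - excess k \<le> t"
    proof -
      have "0 \<le> \<eta> * M"
        using eta by simp
      then show ?thesis
        using k(2) by (simp add: excess_def)
    qed
    show "degree_in G (S i) x - excess i \<le> (1 - \<eta>) * M" if "i \<in> {..<r}" for i
      using degree_le[of i] that by (auto simp: excess_def algebra_simps)
  qed (use k(1) in auto)
  then show ?thesis
    by (simp add: sum_subtractf excess_def)
qed

lemma sum_sum_degree_in_classes_le:
  fixes \<eta> :: real
  assumes V: "finite V" and eta: "0 \<le> \<eta>"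
    and S: "\<And>i. i < r \<Longrightarrow> finite (S i)" "\<And>i. i < r \<Longrightarrow> card (S i) = M"
    and few: "\<And>x. x \<in> V \<Longrightarrow> \<exists>k<r. degree_in G (S k) x < t"
  shows "(\<Sum>x\<in>V. \<Sum>i<r. real (degree_in G (S i) x)) \<le> card V * (t + (real r - 1) * ((1 - \<eta>) * M)) +
    \<eta> * M * (\<Sum>i<r. real (card {x \<in> V. (1 - \<eta>) * M \<le> degree_in G (S i) x}))"
proof -
  let ?good = "\<lambda>i x. (1 - \<eta>) * M \<le> degree_in G (S i) x"
  have "(\<Sum>i<r. real (degree_in G (S i) x)) \<le>
      t + (real r - 1) * ((1 - \<eta>) * M) + (\<Sum>i<r. if ?good i x then \<eta> * M else 0)" if x: "x \<in> V" for x
  proof -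
    obtain k where k: "k < r" "degree_in G (S k) x \<le> t"
      using few[OF x] less_imp_le by blast
    show ?thesis
    proof (rule sum_degree_in_classes_le[where S = S, OF k eta])
      show "degree_in G (S i) x \<le> M" if "i < r" for i
        using degree_in_le_card[OF S(1)[OF that]] S(2)[OF that] by simp
    qed
  qed
  then have "(\<Sum>x\<in>V. \<Sum>i<r. real (degree_in G (S i) x)) \<le>
      (\<Sum>x\<in>V. t + (real r - 1) * ((1 - \<eta>) * M) + (\<Sum>i<r. if ?good i x then \<eta> * M else 0))"
    by (rule sum_mono)
  also have "\<dots> =
    card V * (t + (real r - 1) * ((1 - \<eta>) * M)) + (\<Sum>i<r. \<Sum>x\<in>V. if ?good i x then \<eta> * M else 0)"
    by (simp add: sum.distrib sum.swap[of _ _ V])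
  also have "(\<Sum>i<r. \<Sum>x\<in>V. if ?good i x then \<eta> * M else 0) =
    \<eta> * M * (\<Sum>i<r. real (card {x \<in> V. ?good i x}))"
    using V by (simp add: sum.If_cases sum_distrib_left mult.commute Int_def)
  finally show ?thesis .
qed

text \<open>Every vertex misses almost all of one class, so by double counting almost every vertex is
  adjacent to nearly all of the other classes.\<close>

lemma exists_class_nearly_complete_to_many:
  fixes \<epsilon> \<eta> \<beta> :: real
  assumes V: "finite V" and r: "1 \<le> r" and M: "0 < M" and eta: "0 < \<eta>"
    and S: "\<And>i. i < r \<Longrightarrow> S i \<subseteq> V" "\<And>i. i < r \<Longrightarrow> card (S i) = M"
    and deg: "\<And>i s. i < r \<Longrightarrow> s \<in> S i \<Longrightarrow> (turan_density r - \<beta>) * card V \<le> degree_in G V s"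
    and few: "\<And>x. x \<in> V \<Longrightarrow> \<exists>k<r. degree_in G (S k) x < t"
    and small: "\<beta> * r * M + t \<le> \<eta> * M * (r * \<epsilon>)"
  shows "\<exists>i<r. (turan_density r - \<epsilon>) * card V \<le> card {x \<in> V. (1 - \<eta>) * M \<le> degree_in G (S i) x}"
proof (rule ccontr)
  let ?good = "\<lambda>i. {x \<in> V. (1 - \<eta>) * M \<le> degree_in G (S i) x}"
  assume "\<not> ?thesis"
  then have "(\<Sum>i<r. real (card (?good i))) < (\<Sum>i<r. (turan_density r - \<epsilon>) * card V)"
    using r by (intro sum_strict_mono) (auto simp: not_le lessThan_empty_iff)
  also have "\<dots> = (real r * turan_density r - r * \<epsilon>) * card V"
    by (simp add: algebra_simps)
  also have "\<dots> = (real r - 1 - r * \<epsilon>) * card V"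
    by (simp add: mult_turan_density[OF r])
  finally have few_good: "(\<Sum>i<r. real (card (?good i))) < (real r - 1 - r * \<epsilon>) * card V" .
  have "real r * M * ((turan_density r - \<beta>) * card V) \<le> (\<Sum>x\<in>V. \<Sum>i<r. real (degree_in G (S i) x))"
    by (rule sum_degree_in_classes_ge[where T = M]) (use V S deg in auto)
  also have "\<dots> \<le>
    card V * (t + (real r - 1) * ((1 - \<eta>) * M)) + \<eta> * M * (\<Sum>i<r. real (card (?good i)))"
    by (rule sum_sum_degree_in_classes_le) (use V S(2) few eta finite_subset[OF S(1) V] in auto)
  also have "\<dots> <
    card V * (t + (real r - 1) * ((1 - \<eta>) * M)) + \<eta> * M * ((real r - 1 - r * \<epsilon>) * card V)"
    using few_good eta M by (intro add_strict_left_mono mult_strict_left_mono) auto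
  finally have "((real r * turan_density r) * M - \<beta> * r * M) * card V <
      (t + (real r - 1) * M - \<eta> * M * (r * \<epsilon>)) * card V"
    by (simp add: algebra_simps)
  then have "\<eta> * M * (r * \<epsilon>) < \<beta> * r * M + t"
    by (simp add: mult_turan_density[OF r] mult_less_cancel_right)
  then show False
    using small by simp
qed

definition add_vertex :: "'a \<Rightarrow> 'a set \<Rightarrow> 'a graph \<Rightarrow> 'a graph" where
  "add_vertex z Q G = \<lparr>verts = insert z (verts G), edges = edges G \<union> (\<lambda>x. {z, x}) ` Q\<rparr>"

lemma simple_graph_add_vertex:
  "simple_graph G \<Longrightarrow> z \<notin> verts G \<Longrightarrow> Q \<subseteq> verts G \<Longrightarrow> simple_graph (add_vertex z Q G)"
  by (auto simp: simple_graph_def add_vertex_def card_insert_if)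

lemma card_edges_add_vertex:
  assumes G: "simple_graph G" and z: "z \<notin> verts G" and Q: "Q \<subseteq> verts G"
  shows "card (edges (add_vertex z Q G)) = card (edges G) + card Q"
proof -
  have "edges G \<inter> (\<lambda>x. {z, x}) ` Q = {}"
    using G z by (auto simp: simple_graph_def)
  moreover have "inj_on (\<lambda>x. {z, x}) Q"
    by (auto simp: inj_on_def doubleton_eq_iff)
  moreover have "finite Q"
    using Q finite_verts[OF G] by (rule finite_subset)
  ultimately show ?thesis
    using finite_edges[OF G] by (simp add: add_vertex_def card_Un_disjoint card_image)
qed

lemma embedding_replace_added_vertex:
  assumes F: "simple_graph F" and G: "simple_graph G" and z: "z \<notin> verts G"
    and f: "embedding f F (add_vertex z Q G)" and s: "s \<in> verts G" "s \<notin> f ` verts F"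
    and adj: "\<And>x. x \<in> f ` verts F \<inter> Q \<Longrightarrow> s \<in> nbrs G x"
  shows "embedding (id(z := s) \<circ> f) F G"
  unfolding embedding_def
proof (intro conjI ballI)
  have inj: "inj_on f (verts F)" and img: "f ` verts F \<subseteq> insert z (verts G)"
    using f by (auto simp: embedding_def add_vertex_def)
  have "inj_on (id(z := s)) (f ` verts F)"
    using s(2) by (auto simp: inj_on_def)
  with inj show "inj_on (id(z := s) \<circ> f) (verts F)"
    by (rule comp_inj_on)
  show "(id(z := s) \<circ> f) ` verts F \<subseteq> verts G"
    using img s(1) by auto
  fix e
  assume e: "e \<in> edges F"
  then have "e \<subseteq> verts F"
    using F by (simp add: simple_graph_def)
  have "f ` e \<in> edges (add_vertex z Q G)"
    using f e by (simp add: embedding_def)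
  then consider "f ` e \<in> edges G" | x where "x \<in> Q" "f ` e = {z, x}"
    by (auto simp: add_vertex_def)
  then have "id(z := s) ` f ` e \<in> edges G"
  proof cases
    case 1
    then have "z \<notin> f ` e"
      using G z unfolding simple_graph_def by blast
    then have "id(z := s) ` f ` e = f ` e"
      by (force simp: image_iff)
    then show ?thesis
      using 1 by simp
  next
    case 2
    then have "s \<in> nbrs G x"
      using adj \<open>e \<subseteq> verts F\<close> by blast
    then have "{s, x} \<in> edges G"
      by (simp add: nbrs_def insert_commute)
    moreover have "x \<noteq> z"
      using calculation G z by (auto simp: simple_graph_def)
    ultimately show ?thesis
      using 2 by (simp add: insert_commute)
  qed
  then show "(id(z := s) \<circ> f) ` e \<in> edges G"
    by (simp only: image_comp)
qed

lemma exists_common_nbr_outside: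
  assumes fin: "finite S" "finite Y" and card: "card Y \<le> t" "2 * t < card S" and X: "X \<subseteq> Y"
    and nbr: "\<And>x. x \<in> X \<Longrightarrow> 2 * t * card (S - nbrs G x) \<le> card S"
  shows "\<exists>s\<in>S - Y. \<forall>x\<in>X. s \<in> nbrs G x"
proof -
  define bad where "bad = (\<Union>x\<in>X. S - nbrs G x)"
  have finX: "finite X"
    using X fin(2) by (rule finite_subset)
  have "2 * t * card bad \<le> 2 * t * (\<Sum>x\<in>X. card (S - nbrs G x))"
    unfolding bad_def using finX by (intro mult_left_mono card_UN_le) auto
  also have "\<dots> = (\<Sum>x\<in>X. 2 * t * card (S - nbrs G x))"
    by (simp add: sum_distrib_left)
  also have "\<dots> \<le> of_nat (card X) * card S"
    using nbr by (intro sum_bounded_above)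
  also have "\<dots> \<le> t * card S"
    using card_mono[OF fin(2) X] card(1) by simp
  finally have "t * (2 * card bad) \<le> t * card S"
    by (simp add: mult.assoc mult.left_commute)
  moreover have "bad = {}" if "t = 0"
    using that card(1) X fin(2) by (auto simp: bad_def)
  ultimately have "2 * card bad \<le> card S"
    by (cases "t = 0") auto
  then have "card (bad \<union> Y) < card S"
    using card_Un_le[of bad Y] card by linarith
  moreover have "finite (bad \<union> Y)"
    using fin finX by (auto simp: bad_def)
  ultimately obtain s where "s \<in> S" "s \<notin> bad \<union> Y"
    by (meson card_mono not_le subsetI)
  then show ?thesis
    by (auto simp: bad_def)
qed

lemma ex_number_add_vertex:
  fixes G :: "nat graph"
  assumes F: "simple_graph F" "card (verts F) = t" and G: "simple_graph G" "graph_free F G"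
    and S: "S \<subseteq> verts G" "2 * t < card S"
    and Q: "Q \<subseteq> verts G" "\<And>x. x \<in> Q \<Longrightarrow> 2 * t * card (S - nbrs G x) \<le> card S"
  shows "card (edges G) + card Q \<le> ex_number (card (verts G) + 1) F"
proof -
  obtain z where z: "z \<notin> verts G"
    using ex_new_if_finite[OF infinite_UNIV_nat finite_verts[OF G(1)]] by blast
  let ?G = "add_vertex z Q G"
  have "\<not> embedding f F ?G" for f
  proof
    assume f: "embedding f F ?G"
    have Y: "finite (f ` verts F)" "card (f ` verts F) \<le> t"
      using finite_verts[OF F(1)] F(2) by (auto intro: card_image_le)
    have "finite S"
      using S(1) finite_verts[OF G(1)] by (rule finite_subset)
    then obtain s where "s \<in> S - f ` verts F" "\<forall>x\<in>f ` verts F \<inter> Q. s \<in> nbrs G x"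
      using exists_common_nbr_outside[OF _ Y S(2), of "f ` verts F \<inter> Q"] Q(2) by blast
    then have "embedding (id(z := s) \<circ> f) F G"
      using S(1) by (intro embedding_replace_added_vertex[OF F(1) G(1) z f]) auto
    then show False
      using G(2) graph_free_iff_no_embedding[OF F(1)] by blast
  qed
  then have "card (edges ?G) \<le> ex_number (card (verts ?G)) F"
    using F(1) G(1) z Q(1)
    by (intro card_edges_le_ex_number simple_graph_add_vertex)
      (auto simp: graph_free_iff_no_embedding)
  then show ?thesis
    using card_edges_add_vertex[OF G(1) z Q(1)] z finite_verts[OF G(1)]
    by (simp add: add_vertex_def)
qed

lemma ex_number_add_nearly_complete:
  fixes G :: "nat graph"
  assumes F: "simple_graph F" "card (verts F) = t" "0 < t" and G: "simple_graph G" "graph_free F G"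
    and S: "S \<subseteq> verts G" "2 * t < card S"
  shows "card (edges G) + card {x \<in> verts G. (1 - 1 / (2 * real t)) * card S \<le> degree_in G S x}
    \<le> ex_number (card (verts G) + 1) F"
proof (rule ex_number_add_vertex[OF F(1,2) G S])
  fix x
  assume x: "x \<in> {x \<in> verts G. (1 - 1 / (2 * real t)) * card S \<le> degree_in G S x}"
  have "finite S"
    using S(1) finite_verts[OF G(1)] by (rule finite_subset)
  then have "real (card (S - nbrs G x)) = real (card S) - degree_in G S x"
    using degree_in_le_card[of S G x] by (simp add: card_Diff_subset_Int Int_commute of_nat_diff)
  also have "\<dots> \<le> card S / (2 * real t)"
    using x by (simp add: algebra_simps)
  finally have "2 * real t * card (S - nbrs G x) \<le> card S"
    using F(3) by (simp add: field_simps)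
  then have "real (2 * t * card (S - nbrs G x)) \<le> real (card S)"
    by simp
  then show "2 * t * card (S - nbrs G x) \<le> card S"
    by linarith
qed auto

lemma extremal_high_degree_classes:
  fixes \<beta> :: real
  assumes F: "simple_graph F" "chromatic_number F = Suc r" and r: "2 \<le> r" and beta: "0 < \<beta>"
  shows "\<forall>\<^sub>F n in sequentially. \<forall>G :: 'a graph. G \<in> extremal_graphs n F \<longrightarrow>
    (\<exists>S. high_degree_classes G r M (turan_density r - \<beta>) (verts G) S)"
proof -
  from near_extremal_high_degree_classes[OF r beta, of "card (verts F)" M, where 'a = 'a]
  obtain \<delta> where "0 < \<delta>" and classes: "\<forall>\<^sub>F n in sequentially. \<forall>(G :: 'a graph) V.
      near_extremal r (card (verts F)) \<delta> G V \<longrightarrow> card V = n \<longrightarrow>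
      (\<exists>S. high_degree_classes G r M (turan_density r - \<beta>) V S)" .
  have "\<forall>\<^sub>F n in sequentially. (turan_density r - \<delta>) * (real n)\<^sup>2 / 2 \<le> ex_number n F"
    using eventually_ex_number_ge_density[OF F _ \<open>0 < \<delta>\<close>] r by simp
  with classes show ?thesis
  proof (eventually_elim, intro allI impI)
    fix n and G :: "'a graph"
    assume classes: "\<forall>(G :: 'a graph) V. near_extremal r (card (verts F)) \<delta> G V \<longrightarrow> card V = n \<longrightarrow>
        (\<exists>S. high_degree_classes G r M (turan_density r - \<beta>) V S)"
      and dense: "(turan_density r - \<delta>) * (real n)\<^sup>2 / 2 \<le> ex_number n F"
      and "G \<in> extremal_graphs n F"
    then have G: "simple_graph G" "card (verts G) = n" "graph_free F G"
      "card (edges G) = ex_number n F"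
      by (auto simp: extremal_graphs_def)
    obtain c where "proper_colouring F (Suc r) c"
      using chromatic_number_colouring[OF F(1)] F(2) by auto
    then have "\<not> has_multipartite G (Suc r) (card (verts F)) (verts G)"
      using has_multipartite_embedding[OF F(1) _ order_refl G(1)] G(3)
        graph_free_iff_no_embedding[OF F(1)] by blast
    moreover have "edge_density_ge G (verts G) (turan_density r - \<delta>)"
      using dense G by (simp add: edge_density_ge_def edges_in_verts)
    ultimately show "\<exists>S. high_degree_classes G r M (turan_density r - \<beta>) (verts G) S"
      using classes G(1,2) finite_verts unfolding near_extremal_def by blast
  qed
qed

lemma ex_number_growth_step:
  fixes G :: "nat graph" and \<beta> \<epsilon> :: real
  assumes F: "simple_graph F" "vertex_critical F" "chromatic_number F = Suc r"
    and r: "1 \<le> r" and G: "G \<in> extremal_graphs n F"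
    and S: "high_degree_classes G r M (turan_density r - \<beta>) (verts G) S"
    and M: "2 * card (verts F) < M"
    and small: "\<beta> * r * M + card (verts F) \<le> 1 / (2 * real (card (verts F))) * M * (r * \<epsilon>)"
  shows "ex_number n F + (turan_density r - \<epsilon>) * n \<le> ex_number (n + 1) F"
proof -
  define t where "t = card (verts F)"
  define \<eta> where "\<eta> = 1 / (2 * real t)"
  have t: "0 < t"
    using F(1,2) by (auto simp: t_def vertex_critical_def card_gt_0_iff finite_verts)
  have G: "simple_graph G" "graph_free F G" "card (verts G) = n" "card (edges G) = ex_number n F"
    using assms(5) by (auto simp: extremal_graphs_def)
  have classes: "multipartite_in G r S (verts G)" "\<forall>i<r. card (S i) = M"
    using S by (auto simp: high_degree_classes_def)
  then have SV: "S i \<subseteq> verts G" if "i < r" for i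
    using that by (simp add: multipartite_in_def)
  have few: "\<exists>k<r. degree_in G (S k) x < t" if "x \<in> verts G" for x
    using vertex_critical_free_few_nbrs[OF F _ G(1,2) classes(1) that] by (simp add: t_def)
  have "\<exists>i<r. (turan_density r - \<epsilon>) * card (verts G) \<le>
    card {x \<in> verts G. (1 - \<eta>) * M \<le> degree_in G (S i) x}"
    by (rule exists_class_nearly_complete_to_many[where \<beta> = \<beta> and t = t])
      (use finite_verts[OF G(1)] r t SV S few small M in
        \<open>auto simp: high_degree_classes_def t_def \<eta>_def\<close>)
  then obtain i where i: "i < r"
      and many: "(turan_density r - \<epsilon>) * n \<le>
        card {x \<in> verts G. (1 - \<eta>) * card (S i) \<le> degree_in G (S i) x}"
        (is "_ \<le> real (card ?good)")
    using G(3) classes(2) by auto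
  have "card (edges G) + card ?good \<le> ex_number (card (verts G) + 1) F"
    unfolding \<eta>_def using classes(2) i M
    by (intro ex_number_add_nearly_complete[OF F(1) t_def[symmetric] t G(1,2) SV])
      (auto simp: t_def)
  then have "real (card (edges G) + card ?good) \<le> ex_number (n + 1) F"
    unfolding G(3) by (rule of_nat_mono)
  then show ?thesis
    using many G(4) by simp
qed

text \<open>Adding to an extremal graph a vertex adjacent to the nearly complete vertices of one class
  of a large \<open>K\<^sub>r(M)\<close> keeps it free of \<open>F\<close>: in a copy of \<open>F\<close>, the new vertex could be exchanged
  for an unused vertex of that class.\<close>

theorem ex_number_growth:
  fixes \<epsilon> :: real
  assumes F: "simple_graph F" "vertex_critical F" "chromatic_number F = Suc r" and r: "2 \<le> r"
    and eps: "0 < \<epsilon>"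
  shows "\<forall>\<^sub>F n in sequentially. ex_number n F + (turan_density r - \<epsilon>) * n \<le> ex_number (n + 1) F"
proof -
  define t where "t = card (verts F)"
  have t: "0 < t"
    using F(1,2) by (auto simp: t_def vertex_critical_def card_gt_0_iff finite_verts)
  define \<beta> where "\<beta> = \<epsilon> / (4 * t)"
  define M where "M = 2 * t + 1 + nat \<lceil>4 * (real t)\<^sup>2 / \<epsilon>\<rceil>"
  have beta: "0 < \<beta>"
    using t eps by (simp add: \<beta>_def)
  have "4 * (real t)\<^sup>2 / \<epsilon> \<le> M"
    unfolding M_def by linarith
  then have "4 * (real t)\<^sup>2 \<le> \<epsilon> * M * 1"
    using eps by (simp add: pos_divide_le_eq mult.commute)
  also have "\<dots> \<le> \<epsilon> * M * r"
    using eps r by (intro mult_left_mono) auto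
  finally have "\<beta> * r * M + t \<le> 1 / (2 * real t) * M * (r * \<epsilon>)"
    using t by (simp add: \<beta>_def field_simps power2_eq_square)
  then have step: "ex_number n F + (turan_density r - \<epsilon>) * n \<le> ex_number (n + 1) F"
    if "G \<in> extremal_graphs n F"
      "high_degree_classes G r M (turan_density r - \<beta>) (verts G) S" for n S and G :: "nat graph"
    using r by (intro ex_number_growth_step[OF F _ that]) (auto simp: t_def M_def)
  have "0 < r"
    using r by simp
  show ?thesis
    using extremal_high_degree_classes[OF F(1,3) r beta, of M, where 'a = nat]
    by eventually_elim (metis step exists_extremal_graph[OF F(1,3) \<open>0 < r\<close>])
qed

section \<open>Joins with complete graphs\<close>

lemma simple_graph_join:
  assumes "simple_graph G" "simple_graph H"
  shows "simple_graph (graph_join G H)"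
proof -
  have "card (Inl ` e :: ('a + 'b) set) = card e" for e
    by (simp add: card_image)
  moreover have "card (Inr ` e :: ('a + 'b) set) = card e" for e
    by (simp add: card_image)
  ultimately show ?thesis
    using assms by (auto simp: simple_graph_def graph_join_def card_insert_if)
qed

lemma simple_complete_graph: "simple_graph (complete_graph m)"
  by (auto simp: simple_graph_def complete_graph_def)

lemma card_verts_join:
  "simple_graph G \<Longrightarrow> simple_graph H \<Longrightarrow>
    card (verts (graph_join G H)) = card (verts G) + card (verts H)"
  by (simp add: graph_join_def finite_verts card_Plus)

lemma card_edges_join:
  assumes G: "simple_graph G" and H: "simple_graph H"
  shows "card (edges (graph_join G H)) =
    card (edges G) + card (verts G) * card (verts H) + card (edges H)"
proof -
  let ?A = "(\<lambda>e. Inl ` e) ` edges G :: ('a + 'b) set set"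
  let ?B = "(\<lambda>e. Inr ` e) ` edges H :: ('a + 'b) set set"
  let ?C = "(\<lambda>(u, v). {Inl u, Inr v}) ` (verts G \<times> verts H) :: ('a + 'b) set set"
  have "card ?A = card (edges G)" "card ?B = card (edges H)"
    by (auto intro!: card_image simp: inj_on_def inj_image_eq_iff)
  moreover have "card ?C = card (verts G) * card (verts H)"
    by (subst card_image) (auto simp: inj_on_def doubleton_eq_iff card_cartesian_product)
  moreover have "finite ?A" "finite ?B" "finite ?C"
    using G H by (auto simp: finite_edges finite_verts)
  moreover have "?A \<inter> ?B = {}" "(?A \<union> ?B) \<inter> ?C = {}"
  proof -
    have "e \<noteq> {}" if "e \<in> edges H" for e
      using H that by (auto simp: simple_graph_def)
    then show "?A \<inter> ?B = {}"
      by fastforce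
    have "Inl u \<notin> (Inr ` e :: ('a + 'b) set)" "Inr v \<notin> (Inl ` d :: ('a + 'b) set)" for u e v d
      by auto
    then show "(?A \<union> ?B) \<inter> ?C = {}"
      by auto
  qed
  moreover have "edges (graph_join G H) = ?A \<union> ?B \<union> ?C"
    by (auto simp: graph_join_def)
  ultimately show ?thesis
    by (simp add: card_Un_disjoint)
qed

lemma card_edges_complete_graph: "card (edges (complete_graph m)) = m choose 2"
  using n_subsets[of "{..<m}" 2] by (simp add: complete_graph_def)

lemma card_verts_complete_graph: "card (verts (complete_graph m)) = m"
  by (simp add: complete_graph_def)

lemma card_edges_le_if_embedding:
  assumes "simple_graph G" "simple_graph H" "embedding f G H"
  shows "card (edges G) \<le> card (edges H)"
  using assms inj_on_image_edges[of G f]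
  by (intro card_inj_on_le[of "\<lambda>e. f ` e"]) (auto simp: embedding_def finite_edges)

lemma graph_iso_if_embedding_onto:
  assumes G: "simple_graph G" and H: "simple_graph H"
    and f: "embedding f G H" "f ` verts G = verts H"
    and card: "card (edges G) = card (edges H)"
  shows "graph_iso G H"
proof -
  have inj: "inj_on f (verts G)"
    using f(1) by (simp add: embedding_def)
  have "(\<lambda>e. f ` e) ` edges G = edges H"
  proof (rule card_subset_eq)
    show "(\<lambda>e. f ` e) ` edges G \<subseteq> edges H"
      using f(1) by (auto simp: embedding_def)
    show "card ((\<lambda>e. f ` e) ` edges G) = card (edges H)"
      using card by (simp add: card_image[OF inj_on_image_edges[OF G inj]])
  qed (rule finite_edges[OF H])
  then show ?thesis
    using inj f(2) unfolding graph_iso_def bij_betw_def by blast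
qed

lemma Inl_edge_join: "{x, y} \<in> edges G \<Longrightarrow> {Inl x, Inl y} \<in> edges (graph_join G H)"
  by (auto simp: graph_join_def intro!: image_eqI[of _ _ "{x, y}"])

lemma Inr_edge_join: "{x, y} \<in> edges H \<Longrightarrow> {Inr x, Inr y} \<in> edges (graph_join G H)"
  by (auto simp: graph_join_def intro!: image_eqI[of _ _ "{x, y}"])

lemma cross_edge_join: "x \<in> verts G \<Longrightarrow> y \<in> verts H \<Longrightarrow> {Inl x, Inr y} \<in> edges (graph_join G H)"
  by (auto simp: graph_join_def)

lemma image_edge_join_complete:
  assumes bij: "bij_betw b W (verts (complete_graph m))" and e: "{x, y} \<in> edges G"
    and x: "x \<in> verts G" and y: "y \<in> verts G" "x \<noteq> y"
  defines "f \<equiv> \<lambda>v. if v \<in> W then Inl (b v) else Inr v"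
  shows "{f x, f y} \<in> edges (graph_join (complete_graph m) (induced G (verts G - W)))"
    (is "_ \<in> edges ?J")
proof -
  consider "x \<in> W" "y \<in> W" | "x \<in> W" "y \<notin> W" | "x \<notin> W" "y \<in> W" | "x \<notin> W" "y \<notin> W"
    by blast
  then show ?thesis
  proof cases
    case 1
    then have "b x \<noteq> b y" "b x < m" "b y < m"
      using bij y(2) by (auto simp: bij_betw_def inj_on_def complete_graph_def)
    then have "{b x, b y} \<in> edges (complete_graph m)"
      by (simp add: complete_graph_def)
    then show ?thesis
      using 1 by (simp add: f_def Inl_edge_join)
  next
    case 2
    then have "{Inl (b x), Inr y} \<in> edges ?J"
      using bij y(1) by (intro cross_edge_join) (auto simp: induced_def bij_betw_def)
    then show ?thesis
      using 2 by (simp add: f_def)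
  next
    case 3
    then have "{Inl (b y), Inr x} \<in> edges ?J"
      using bij x by (intro cross_edge_join) (auto simp: induced_def bij_betw_def)
    then show ?thesis
      using 3 by (simp add: f_def insert_commute)
  next
    case 4
    then have "{x, y} \<in> edges (induced G (verts G - W))"
      using e x y by (auto simp: induced_def edges_in_def)
    then show ?thesis
      using 4 by (simp add: f_def Inr_edge_join)
  qed
qed

lemma embedding_onto_join_complete:
  assumes G: "simple_graph G" and W: "W \<subseteq> verts G"
  defines "J \<equiv> graph_join (complete_graph (card W)) (induced G (verts G - W))"
  shows "\<exists>f. embedding f G J \<and> f ` verts G = verts J"
proof -
  have "finite W"
    using W finite_verts[OF G] by (rule finite_subset)
  then obtain b where bij: "bij_betw b W (verts (complete_graph (card W)))"
    using ex_bij_betw_finite_nat[of W] by (auto simp: complete_graph_def atLeast0LessThan)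
  define f where "f v = (if v \<in> W then Inl (b v) else Inr v)" for v
  have inj: "inj_on f (verts G)"
    using bij by (auto simp: f_def inj_on_def bij_betw_def)
  have "f ` W = Inl ` verts (complete_graph (card W))"
    unfolding bij_betw_imp_surj_on[OF bij, symmetric] by (auto simp: f_def image_image)
  moreover have "f ` (verts G - W) = Inr ` (verts G - W)"
    by (auto simp: f_def)
  moreover have "f ` verts G = f ` W \<union> f ` (verts G - W)"
    using W by auto
  ultimately have onto: "f ` verts G = verts J"
    by (simp add: J_def graph_join_def induced_def Plus_def)
  have "f ` e \<in> edges J" if e: "e \<in> edges G" for e
  proof -
    obtain x y where xy: "e = {x, y}" "x \<noteq> y" "x \<in> verts G" "y \<in> verts G"
      using G e by (rule simple_graph_edgeE)
    then have "{f x, f y} \<in> edges J"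
      using image_edge_join_complete[OF bij, of x y G] e by (simp add: J_def f_def)
    then show ?thesis
      using xy(1) by simp
  qed
  then show ?thesis
    using inj onto unfolding embedding_def by blast
qed

lemma embedding_right_of_join:
  assumes F: "simple_graph F" and f: "embedding f F (graph_join G H)"
    and right: "f ` verts F \<inter> Inl ` verts G = {}"
  shows "embedding (projr \<circ> f) F H"
proof -
  have Inr: "f x = Inr (projr (f x)) \<and> projr (f x) \<in> verts H" if "x \<in> verts F" for x
  proof -
    have "f x \<in> verts G <+> verts H"
      using f that by (auto simp: embedding_def graph_join_def)
    then show ?thesis
      using right that by auto
  qed
  have "inj_on (projr \<circ> f) (verts F)"
  proof (rule inj_onI)
    fix x y
    assume "x \<in> verts F" "y \<in> verts F" "(projr \<circ> f) x = (projr \<circ> f) y"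
    then show "x = y"
      using Inr[of x] Inr[of y] f by (auto simp: embedding_def inj_on_def)
  qed
  moreover have "(projr \<circ> f) ` e \<in> edges H" if e: "e \<in> edges F" for e
  proof -
    have "e \<subseteq> verts F" "e \<noteq> {}"
      using F e by (auto simp: simple_graph_def)
    have img: "f ` e = Inr ` (projr \<circ> f) ` e"
      unfolding image_image using Inr \<open>e \<subseteq> verts F\<close> by (intro image_cong) auto
    have "f ` e \<in> edges (graph_join G H)"
      using f e by (simp add: embedding_def)
    moreover have "Inr ` d \<noteq> Inl ` d'" if "d \<noteq> {}" for d :: "'c set" and d' :: "'b set"
      using that by auto
    moreover have "Inr ` d \<noteq> {Inl u, Inr v}" for d :: "'c set" and u :: 'b and v
      by auto
    ultimately obtain d where "d \<in> edges H" "Inr ` (projr \<circ> f) ` e = Inr ` d"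
      using \<open>e \<noteq> {}\<close> unfolding img graph_join_def by fastforce
    then show ?thesis
      by (metis inj_Inr inj_image_eq_iff)
  qed
  ultimately show ?thesis
    using Inr by (auto simp: embedding_def)
qed

section \<open>Disjoint unions and packings\<close>

lemma simple_graph_disjoint_union:
  assumes "finite I" "\<And>i. i \<in> I \<Longrightarrow> simple_graph (F i)"
  shows "simple_graph (disjoint_union I F)"
proof -
  have "card (Pair i ` e) = card e" for i :: 'a and e :: "'b set"
    by (intro card_image) (auto simp: inj_on_def)
  then show ?thesis
    using assms by (auto simp: simple_graph_def disjoint_union_def) blast
qed

lemma card_verts_disjoint_union:
  assumes "finite I" "\<And>i. i \<in> I \<Longrightarrow> simple_graph (F i)"
  shows "card (verts (disjoint_union I F)) = (\<Sum>i\<in>I. card (verts (F i)))"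
  using assms by (simp add: disjoint_union_def finite_verts)

lemma embedding_Pair_disjoint_union: "i \<in> I \<Longrightarrow> embedding (Pair i) (F i) (disjoint_union I F)"
  by (auto simp: embedding_def disjoint_union_def inj_on_def)

lemma proper_colouring_disjoint_union:
  assumes colouring: "\<And>i. i \<in> I \<Longrightarrow> proper_colouring (F i) k (c i)"
  shows "proper_colouring (disjoint_union I F) k (\<lambda>(i, x). c i x)"
  unfolding proper_colouring_def
proof (intro conjI allI impI)
  show "(\<lambda>(i, x). c i x) ` verts (disjoint_union I F) \<subseteq> {..<k}"
    using colouring by (fastforce simp: disjoint_union_def proper_colouring_def)
  fix p q
  assume "{p, q} \<in> edges (disjoint_union I F)"
  then obtain i e where ie: "i \<in> I" "e \<in> edges (F i)" "{p, q} = Pair i ` e"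
    by (auto simp: disjoint_union_def)
  then have "p \<in> Pair i ` e" "q \<in> Pair i ` e"
    by blast+
  then obtain x y where xy: "p = (i, x)" "q = (i, y)"
    by blast
  then have "Pair i ` {x, y} = Pair i ` e"
    using ie(3) by simp
  then have "e = {x, y}"
    by (metis inj_image_eq_iff inj_onI prod.inject)
  then show "(case p of (i, x) \<Rightarrow> c i x) \<noteq> (case q of (i, x) \<Rightarrow> c i x)"
    using colouring[OF ie(1)] ie(2) xy by (auto simp: proper_colouring_def)
qed

lemma disjoint_union_free_join:
  assumes F: "finite I" "\<And>i. i \<in> I \<Longrightarrow> simple_graph (F i)" and J: "J \<subseteq> I" "card (verts G) < card J"
    and G: "simple_graph G" and free: "\<And>j. j \<in> J \<Longrightarrow> graph_free (F j) H"
  shows "graph_free (disjoint_union I F) (graph_join G H)"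
proof -
  have U: "simple_graph (disjoint_union I F)"
    using F by (rule simple_graph_disjoint_union)
  have "False" if f: "embedding f (disjoint_union I F) (graph_join G H)" for f
  proof -
    have "\<exists>x\<in>verts (F j). f (j, x) \<in> Inl ` verts G" if j: "j \<in> J" for j
    proof (rule ccontr)
      assume avoids: "\<not> ?thesis"
      have "j \<in> I"
        using j J(1) by blast
      have "embedding (f \<circ> Pair j) (F j) (graph_join G H)"
        using embedding_comp[OF embedding_Pair_disjoint_union[OF \<open>j \<in> I\<close>] f] .
      then have "embedding (projr \<circ> (f \<circ> Pair j)) (F j) H"
        using avoids by (intro embedding_right_of_join F(2)[OF \<open>j \<in> I\<close>]) auto
      then show False
        using free[OF j] graph_free_iff_no_embedding[OF F(2)[OF \<open>j \<in> I\<close>]] by blast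
    qed
    then obtain x where x: "\<And>j. j \<in> J \<Longrightarrow> x j \<in> verts (F j) \<and> f (j, x j) \<in> Inl ` verts G"
      by metis
    have inj: "inj_on f (SIGMA i:I. verts (F i))"
      using f by (simp add: embedding_def disjoint_union_def)
    have "inj_on (\<lambda>j. f (j, x j)) J"
    proof (rule inj_onI)
      fix j k
      assume "j \<in> J" "k \<in> J" "f (j, x j) = f (k, x k)"
      then show "j = k"
        using inj_onD[OF inj, of "(j, x j)" "(k, x k)"] x J(1) by auto
    qed
    then have "card J = card ((\<lambda>j. f (j, x j)) ` J)"
      by (simp add: card_image)
    also have "\<dots> \<le> card (verts G)"
      using x by (intro surj_card_le[OF finite_verts[OF G], of _ Inl]) auto
    finally show False
      using J(2) by simp
  qed
  then show ?thesis
    using graph_free_iff_no_embedding[OF U] by blast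
qed

lemma embedding_disjoint_union_singleton:
  assumes "embedding g (F i) G"
  shows "embedding (g \<circ> snd) (disjoint_union {i} F) G"
    and "(g \<circ> snd) ` verts (disjoint_union {i} F) = g ` verts (F i)"
proof -
  have verts: "verts (disjoint_union {i} F) = Pair i ` verts (F i)"
    by (auto simp: disjoint_union_def)
  show img: "(g \<circ> snd) ` verts (disjoint_union {i} F) = g ` verts (F i)"
    by (simp add: verts image_image)
  show "embedding (g \<circ> snd) (disjoint_union {i} F) G"
    using assms unfolding embedding_def img
    by (auto simp: disjoint_union_def inj_on_def image_image)
qed

lemma embedding_disjoint_union_insert:
  assumes f: "embedding f (disjoint_union I F) G" and i: "i \<notin> I" and g: "embedding g (F i) G"
    and disj: "g ` verts (F i) \<inter> f ` verts (disjoint_union I F) = {}"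
  shows "\<exists>f'. embedding f' (disjoint_union (insert i I) F) G \<and>
    f' ` verts (disjoint_union (insert i I) F) = g ` verts (F i) \<union> f ` verts (disjoint_union I F)"
proof -
  define f' where "f' = (\<lambda>(j, x). if j = i then g x else f (j, x))"
  have verts: "verts (disjoint_union (insert i I) F) =
    Pair i ` verts (F i) \<union> verts (disjoint_union I F)"
    by (auto simp: disjoint_union_def)
  have edges: "edges (disjoint_union (insert i I) F) =
    (\<lambda>e. Pair i ` e) ` edges (F i) \<union> edges (disjoint_union I F)"
    by (auto simp: disjoint_union_def)
  have new: "f' ` Pair i ` A = g ` A" for A
    by (simp add: f'_def image_image)
  have old: "f' p = f p" if "fst p \<in> I" for p
    using i that by (auto simp: f'_def split: prod.split)
  have old_verts: "f' ` verts (disjoint_union I F) = f ` verts (disjoint_union I F)"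
    by (intro image_cong refl old) (auto simp: disjoint_union_def)
  have old_edges: "f' ` e = f ` e" if "e \<in> edges (disjoint_union I F)" for e
    using that by (intro image_cong refl old) (auto simp: disjoint_union_def)
  have img: "f' ` verts (disjoint_union (insert i I) F) =
    g ` verts (F i) \<union> f ` verts (disjoint_union I F)"
    by (simp add: verts image_Un new old_verts)
  have "inj_on f' (verts (disjoint_union (insert i I) F))"
    unfolding verts inj_on_Un
  proof (intro conjI)
    show "inj_on f' (Pair i ` verts (F i))"
      using g by (auto simp: embedding_def inj_on_def f'_def)
    show "inj_on f' (verts (disjoint_union I F))"
      using f old by (auto simp: embedding_def inj_on_def disjoint_union_def)
    have "f' ` Pair i ` verts (F i) \<inter> f' ` verts (disjoint_union I F) = {}"
      using disj by (simp add: new old_verts)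
    then show "f' ` (Pair i ` verts (F i) - verts (disjoint_union I F)) \<inter>
        f' ` (verts (disjoint_union I F) - Pair i ` verts (F i)) = {}"
      by blast
  qed
  moreover have "f' ` e \<in> edges G" if "e \<in> edges (disjoint_union (insert i I) F)" for e
    using that f g unfolding edges by (auto simp: new old_edges embedding_def)
  ultimately have "embedding f' (disjoint_union (insert i I) F) G"
    using img f g by (auto simp: embedding_def)
  then show ?thesis
    using img by blast
qed

definition robust_host :: "nat \<Rightarrow> 'f graph \<Rightarrow> 'a graph \<Rightarrow> 'a \<Rightarrow> bool" where
  "robust_host K F G w \<longleftrightarrow> (\<forall>Z. finite Z \<longrightarrow> card Z \<le> K \<longrightarrow>
     (\<exists>g. embedding g F G \<and> g ` verts F \<subseteq> insert w (verts G - Z)))"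

lemma packing_insert_by_robust_host:
  assumes f: "embedding f (disjoint_union I F) G"
    and I: "finite I" "\<And>i. i \<in> I \<Longrightarrow> simple_graph (F i)" "j \<notin> I"
    and host: "robust_host K (F j) G w" and w: "w \<notin> W" "w \<notin> f ` verts (disjoint_union I F)"
    and W: "finite W" "W \<inter> f ` verts (disjoint_union I F) = {}"
    and size_le: "card W + (\<Sum>i\<in>I. card (verts (F i))) \<le> K"
  shows "\<exists>f'. embedding f' (disjoint_union (insert j I) F) G \<and>
    W \<inter> f' ` verts (disjoint_union (insert j I) F) = {}"
proof -
  define X where "X = f ` verts (disjoint_union I F)"
  have finite: "finite (verts (disjoint_union I F))"
    using I(1,2) by (intro finite_verts simple_graph_disjoint_union)
  then have "card X \<le> card (verts (disjoint_union I F))"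
    unfolding X_def by (rule card_image_le)
  also have "\<dots> = (\<Sum>i\<in>I. card (verts (F i)))"
    using I(1,2) by (rule card_verts_disjoint_union)
  finally have "card X \<le> (\<Sum>i\<in>I. card (verts (F i)))" .
  then have "card (W \<union> X) \<le> K"
    using size_le card_Un_le[of W X] by linarith
  moreover have "finite (W \<union> X)"
    using W(1) finite by (simp add: X_def)
  ultimately obtain g
    where g: "embedding g (F j) G" "g ` verts (F j) \<subseteq> insert w (verts G - (W \<union> X))"
    using host unfolding robust_host_def by blast
  have "g ` verts (F j) \<inter> f ` verts (disjoint_union I F) = {}"
    using g(2) w(2) by (auto simp: X_def)
  then obtain f' where f': "embedding f' (disjoint_union (insert j I) F) G"
      "f' ` verts (disjoint_union (insert j I) F) =
        g ` verts (F j) \<union> f ` verts (disjoint_union I F)"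
    using embedding_disjoint_union_insert[where F = F, OF f I(3) g(1)] by blast
  have "W \<inter> f' ` verts (disjoint_union (insert j I) F) = {}"
    unfolding f'(2) using g(2) w(1) W(2) by blast
  then show ?thesis
    using f'(1) by blast
qed

lemma packing_extend_by_robust_hosts:
  assumes "finite J" "finite I" "I \<inter> J = {}" "finite W" "card W = card J"
    and "\<And>i. i \<in> I \<union> J \<Longrightarrow> simple_graph (F i)"
    and "embedding f (disjoint_union I F) G" "W \<inter> f ` verts (disjoint_union I F) = {}"
    and "\<And>w i. w \<in> W \<Longrightarrow> i \<in> J \<Longrightarrow> robust_host K (F i) G w"
    and "card W + (\<Sum>i\<in>I \<union> J. card (verts (F i))) \<le> K"
  shows "\<exists>f. embedding f (disjoint_union (I \<union> J) F) G"
  using assms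
proof (induction J arbitrary: I W f rule: finite_induct)
  case empty
  then show ?case
    by auto
next
  case (insert j J)
  have "W \<noteq> {}"
    using \<open>card W = card (insert j J)\<close> insert.hyps by auto
  then obtain w where w: "w \<in> W"
    by blast
  have cardW: "card W = Suc (card (W - {w}))"
    using \<open>finite W\<close> w by (rule card.remove)
  have "(\<Sum>i\<in>I. card (verts (F i))) \<le> (\<Sum>i\<in>I \<union> insert j J. card (verts (F i)))"
    using \<open>finite I\<close> insert.hyps(1) by (intro sum_mono2) auto
  then have "card (W - {w}) + (\<Sum>i\<in>I. card (verts (F i))) \<le> K"
    using insert.prems(9) cardW by linarith
  then have "\<exists>f'. embedding f' (disjoint_union (insert j I) F) G \<and>
      (W - {w}) \<inter> f' ` verts (disjoint_union (insert j I) F) = {}"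
    using insert.prems w by (intro packing_insert_by_robust_host[OF insert.prems(6)]) auto
  then obtain f' where f': "embedding f' (disjoint_union (insert j I) F) G"
      "(W - {w}) \<inter> f' ` verts (disjoint_union (insert j I) F) = {}"
    by blast
  have "\<exists>f. embedding f (disjoint_union (insert j I \<union> J) F) G"
  proof (rule insert.IH)
    show "embedding f' (disjoint_union (insert j I) F) G"
      by (rule f'(1))
    show "card (W - {w}) = card J"
      using cardW \<open>card W = card (insert j J)\<close> insert.hyps by simp
    show "card (W - {w}) + (\<Sum>i\<in>insert j I \<union> J. card (verts (F i))) \<le> K"
      using insert.prems(9) cardW by simp
  qed (use insert.prems insert.hyps f'(2) in auto)
  then show ?case
    by simp
qed

lemma exists_maximal_packing:
  assumes J: "finite J" "i \<in> J" and g: "embedding g (F i) G" "g ` verts (F i) \<subseteq> A"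
  shows "\<exists>I f. i \<in> I \<and> I \<subseteq> J \<and> embedding f (disjoint_union I F) G \<and>
    f ` verts (disjoint_union I F) \<subseteq> A \<and>
    (\<forall>j\<in>J - I. \<nexists>g. embedding g (F j) G \<and> g ` verts (F j) \<subseteq> A - f ` verts (disjoint_union I F))"
proof -
  define P where "P = {I. i \<in> I \<and> I \<subseteq> J \<and>
    (\<exists>f. embedding f (disjoint_union I F) G \<and> f ` verts (disjoint_union I F) \<subseteq> A)}"
  have "embedding (g \<circ> snd) (disjoint_union {i} F) G" "(g \<circ> snd) ` verts (disjoint_union {i} F) \<subseteq> A"
    using embedding_disjoint_union_singleton[where F = F and i = i, OF g(1)] g(2) by simp_all
  then have "{i} \<in> P"
    using J(2) unfolding P_def by blast
  moreover have "finite P"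
    by (rule finite_subset[of _ "Pow J"]) (auto simp: P_def J(1))
  ultimately obtain I where I: "I \<in> P" "\<And>I'. I' \<in> P \<Longrightarrow> I \<subseteq> I' \<Longrightarrow> I = I'"
    using finite_has_maximal[of P] by auto
  then obtain f where f: "embedding f (disjoint_union I F) G" "f ` verts (disjoint_union I F) \<subseteq> A"
    by (auto simp: P_def)
  have False if j: "j \<in> J - I"
    and g: "embedding g (F j) G" "g ` verts (F j) \<subseteq> A - f ` verts (disjoint_union I F)" for j g
  proof -
    have "g ` verts (F j) \<inter> f ` verts (disjoint_union I F) = {}" "j \<notin> I"
      using j g(2) by auto
    then obtain f' where f': "embedding f' (disjoint_union (insert j I) F) G"
        "f' ` verts (disjoint_union (insert j I) F) =
          g ` verts (F j) \<union> f ` verts (disjoint_union I F)"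
      using embedding_disjoint_union_insert[where F = F, OF f(1) _ g(1)] by blast
    then have "f' ` verts (disjoint_union (insert j I) F) \<subseteq> A"
      using g(2) f(2) by blast
    then have "insert j I \<in> P"
      using f'(1) I(1) j by (auto simp: P_def)
    then show False
      using I(2)[of "insert j I"] j by blast
  qed
  moreover have "i \<in> I" "I \<subseteq> J"
    using I(1) by (auto simp: P_def)
  ultimately show ?thesis
    using f by blast
qed

section \<open>Extremal graphs for the disjoint union\<close>

lemma eventually_ex_number_growth_iterated:
  fixes \<epsilon> :: real
  assumes F: "simple_graph F" "vertex_critical F" "chromatic_number F = Suc r" and r: "2 \<le> r"
    and eps: "0 < \<epsilon>" "\<epsilon> \<le> turan_density r"
  shows "\<forall>\<^sub>F n in sequentially. \<forall>k. ex_number n F + k * ((turan_density r - \<epsilon>) * n) \<le>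
    ex_number (n + k) F"
proof -
  have "\<forall>\<^sub>F n in sequentially. \<forall>m\<ge>n. ex_number m F + (turan_density r - \<epsilon>) * m \<le>
    ex_number (m + 1) F"
    using ex_number_growth[OF F r eps(1)] by (rule eventually_all_ge_at_top)
  then show ?thesis
  proof eventually_elim
    case (elim n)
    show ?case
    proof
      fix k
      show "ex_number n F + k * ((turan_density r - \<epsilon>) * n) \<le> ex_number (n + k) F"
      proof (induction k)
        case 0
        then show ?case
          by simp
      next
        case (Suc k)
        have "(turan_density r - \<epsilon>) * n \<le> (turan_density r - \<epsilon>) * (n + k)"
          using eps(2) by (intro mult_left_mono) auto
        moreover have "ex_number (n + k) F + (turan_density r - \<epsilon>) * (n + k) \<le>
          ex_number (n + Suc k) F"
          using elim[rule_format, of "n + k"] by simp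
        ultimately show ?case
          using Suc.IH by (simp add: algebra_simps)
      qed
    qed
  qed
qed

text \<open>The coefficients of \<open>N\<close> on the two sides differ by \<open>1/r - (2k + 1)\<epsilon>\<close>, which is at least
  \<open>1/(2r)\<close>.\<close>

lemma edge_surplus:
  fixes s k t h r \<epsilon> N :: real
  assumes bounds: "0 \<le> s" "s \<le> h" "0 \<le> k" "k + 1 \<le> t" "2 \<le> r"
    and eps: "0 \<le> \<epsilon>" "\<epsilon> \<le> 1" "2 * t * \<epsilon> = 1 / (2 * r)"
    and N: "2 * r * ((h + 2 * t) * (h + t)) < N"
  shows "s * (N + s + k + 1) + (k + 1) * ((1 - 1 / r + \<epsilon>) * (N + s + k + 1)) <
    (s + 1) * (N + k) + k * ((1 - 1 / r - \<epsilon>) * N)"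
proof -
  define c where "c = s + (k + 1) * (1 - 1 / r + \<epsilon>)"
  have "0 \<le> 1 / r"
    using bounds(5) by simp
  then have "1 - 1 / r + \<epsilon> \<le> 2"
    using eps(2) by linarith
  then have "(k + 1) * (1 - 1 / r + \<epsilon>) \<le> (k + 1) * 2"
    using bounds(3) by (intro mult_left_mono) auto
  then have "c \<le> h + t * 2"
    using bounds by (simp add: c_def)
  moreover have "s + k + 1 \<le> h + t"
    using bounds by linarith
  ultimately have "c * (s + k + 1) \<le> (h + t * 2) * (h + t)"
    using bounds by (intro mult_mono) auto
  moreover have "(h + t * 2) * (h + t) < N / (2 * r)"
    using N bounds(5) by (simp add: pos_less_divide_eq mult.commute)
  moreover have "N / (2 * r) \<le> (1 / r - (2 * k + 1) * \<epsilon>) * N"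
  proof -
    have "0 \<le> 2 * r * ((h + 2 * t) * (h + t))"
      using bounds by (intro mult_nonneg_nonneg) auto
    then have "0 \<le> N"
      using N by linarith
    have "(2 * k + 1) * \<epsilon> \<le> 2 * t * \<epsilon>"
      using bounds eps(1) by (intro mult_right_mono) auto
    then have "1 / (2 * r) \<le> 1 / r - (2 * k + 1) * \<epsilon>"
      using eps(3) by simp
    then show ?thesis
      using mult_right_mono[OF _ \<open>0 \<le> N\<close>] by fastforce
  qed
  moreover have "s * (N + s + k + 1) + (k + 1) * ((1 - 1 / r + \<epsilon>) * (N + s + k + 1)) =
    c * N + c * (s + k + 1)"
    by (simp add: c_def algebra_simps add_divide_distrib)
  moreover have "(s + 1) * (N + k) + k * ((1 - 1 / r - \<epsilon>) * N) =
      c * N + (1 / r - (2 * k + 1) * \<epsilon>) * N + (s + 1) * k"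
    by (simp add: c_def algebra_simps add_divide_distrib)
  moreover have "0 \<le> (s + 1) * k"
    using bounds by simp
  ultimately show ?thesis
    by linarith
qed

lemma card_edges_le_after_deletion:
  fixes D :: real
  assumes F: "simple_graph F" and G: "simple_graph G" and WX: "W \<subseteq> verts G" "X \<subseteq> verts G - W"
    and deg: "\<And>x. x \<in> X \<Longrightarrow> degree_in G (verts G) x \<le> D"
    and free: "graph_free F (induced G (verts G - W - X))"
  shows "card (edges G) \<le> card W * real (card (verts G)) + card X * D +
    ex_number (card (verts G) - card W - card X) F"
proof -
  note fin = finite_verts[OF G]
  have "card (edges_in G (verts G)) \<le>
    card (edges_in G (verts G - W)) + card W * real (card (verts G))"
    using fin WX(1) by (intro card_edges_in_Diff_le[OF G]) (auto intro: card_mono)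
  moreover have "card (edges_in G (verts G - W)) \<le> card (edges_in G (verts G - W - X)) + card X * D"
  proof (rule card_edges_in_Diff_le[OF G _ WX(2)])
    fix x
    assume "x \<in> X"
    moreover have "degree_in G (verts G - W) x \<le> degree_in G (verts G) x"
      using fin by (intro card_mono) auto
    ultimately show "degree_in G (verts G - W) x \<le> D"
      using deg[of x] by linarith
  qed (use fin in simp)
  moreover have "card (edges_in G (verts G - W - X)) \<le>
    ex_number (card (verts G) - card W - card X) F"
  proof -
    have "finite W" "finite X"
      using WX fin finite_subset by (blast, blast)
    then have "card (verts G - W - X) = card (verts G) - card W - card X"
      using WX by (simp add: card_Diff_subset)
    then show ?thesis
      using card_edges_le_ex_number[OF F simple_graph_induced[OF G] free] fin
      by (simp add: induced_def)
  qed
  ultimately show ?thesis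
    by (simp add: edges_in_verts[OF G])
qed

locale properly_ordered_critical_family =
  fixes F :: "nat \<Rightarrow> 'f graph" and h r :: nat
  assumes h: "1 \<le> h" and r: "2 \<le> r"
    and simple: "\<And>i. i \<in> {1..h} \<Longrightarrow> simple_graph (F i)"
    and critical: "\<And>i. i \<in> {1..h} \<Longrightarrow> vertex_critical (F i)"
    and chromatic: "\<And>i. i \<in> {1..h} \<Longrightarrow> chromatic_number (F i) = Suc r"
    and ordered: "properly_ordered h F"
begin

abbreviation union_graph :: "(nat \<times> 'f) graph" where
  "union_graph \<equiv> disjoint_union {1..h} F"

definition join_edges :: "nat \<Rightarrow> nat \<Rightarrow> nat" where
  "join_edges n l = ((l - 1) choose 2) + (l - 1) * (n - l + 1) + ex_number (n - l + 1) (F l)"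

definition total_verts :: nat where
  "total_verts = (\<Sum>i\<in>{1..h}. card (verts (F i)))"

definition eps :: real where
  "eps = 1 / (4 * real total_verts * real r)"

definition high_degree_verts :: "'a graph \<Rightarrow> 'a set" where
  "high_degree_verts G =
     {v \<in> verts G. (turan_density r + eps) * card (verts G) \<le> degree_in G (verts G) v}"

definition competitive :: "'a graph \<Rightarrow> bool" where
  "competitive G \<longleftrightarrow> simple_graph G \<and> graph_free union_graph G \<and>
     (\<forall>l\<in>{1..h}. join_edges (card (verts G)) l \<le> card (edges G))"

text \<open>If \<open>s\<close> vertices and then \<open>k + 1\<close> vertices of low degree are removed from a graph, the
  remaining \<open>N\<close> vertices spanning no \<open>F j\<close>, then the left-hand side bounds its number of edges;
  the right-hand side is at most the number of edges of \<open>K\<^bsub>s+1\<^esub>\<close> joined to an extremal graph for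
  \<open>F (s + 2)\<close>.\<close>

definition has_edge_surplus :: "nat \<Rightarrow> bool" where
  "has_edge_surplus N \<longleftrightarrow> (\<forall>s k. \<forall>j\<in>{s + 2..h}. k < total_verts \<longrightarrow>
     real s * (real N + s + k + 1) + (real k + 1) * ((turan_density r + eps) * (real N + s + k + 1))
       + ex_number N (F j) <
     (real s + 1) * (real N + k) + ex_number (N + k) (F (s + 2)))"

lemma simple_union_graph: "simple_graph union_graph"
  using simple by (intro simple_graph_disjoint_union) auto

lemma card_verts_union_graph: "card (verts union_graph) = total_verts"
  unfolding total_verts_def using simple
  by (rule card_verts_disjoint_union[OF finite_atLeastAtMost])

lemma card_verts_le_total_verts: "i \<in> {1..h} \<Longrightarrow> card (verts (F i)) \<le> total_verts"
  unfolding total_verts_def by (rule member_le_sum) auto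

lemma verts_nonempty: "i \<in> {1..h} \<Longrightarrow> verts (F i) \<noteq> {}"
  using critical by (auto simp: vertex_critical_def)

lemma total_verts_pos: "1 \<le> total_verts"
proof -
  have "1 \<in> {1..h}"
    using h by simp
  then have "0 < card (verts (F 1))"
    using simple verts_nonempty by (simp add: card_gt_0_iff finite_verts)
  then show ?thesis
    using card_verts_le_total_verts[OF \<open>1 \<in> {1..h}\<close>] by linarith
qed

lemma eps_bounds: "0 < eps" "eps \<le> 1 / 8" "2 * total_verts * eps = 1 / (2 * r)"
proof -
  have "1 * 2 \<le> real total_verts * real r"
    using total_verts_pos r by (intro mult_mono) auto
  then show "0 < eps" "eps \<le> 1 / 8"
    by (auto simp: eps_def field_simps)
  show "2 * total_verts * eps = 1 / (2 * r)"
    using total_verts_pos by (simp add: eps_def)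
qed

lemma eventually_ex_number_antimono:
  "\<forall>\<^sub>F n in sequentially. \<forall>l\<in>{1..h}. \<forall>j\<in>{1..l}. ex_number n (F l) \<le> ex_number n (F j)"
  using ordered unfolding properly_ordered_def
proof (eventually_elim, intro ballI)
  fix n l j
  assume attained: "\<forall>l\<in>{1..h}. \<exists>G :: nat graph. G \<in> extremal_graphs n (F l) \<and>
    (\<forall>j\<in>{1..l}. graph_free (F j) G)"
    and l: "l \<in> {1..h}" and j: "j \<in> {1..l}"
  obtain G :: "nat graph" where "G \<in> extremal_graphs n (F l)" "graph_free (F j) G"
    using attained l j by blast
  moreover have "simple_graph (F j)"
    using simple l j by auto
  ultimately show "ex_number n (F l) \<le> ex_number n (F j)"
    using card_edges_le_ex_number[of "F j" G] by (auto simp: extremal_graphs_def)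
qed

lemma eventually_join_edges_attained:
  "\<forall>\<^sub>F n in sequentially. \<forall>l\<in>{1..h}. \<exists>G :: (nat + nat) graph.
    simple_graph G \<and> card (verts G) = n \<and>
    graph_free union_graph G \<and> card (edges G) = join_edges n l"
proof -
  obtain n0 where n0: "\<And>n l. n0 \<le> n \<Longrightarrow> l \<in> {1..h} \<Longrightarrow>
      \<exists>H :: nat graph. H \<in> extremal_graphs n (F l) \<and> (\<forall>j\<in>{1..l}. graph_free (F j) H)"
    using ordered unfolding properly_ordered_def eventually_sequentially by blast
  have "\<exists>G :: (nat + nat) graph.
      simple_graph G \<and> card (verts G) = n \<and>
      graph_free union_graph G \<and> card (edges G) = join_edges n l"
    if n: "n0 + h \<le> n" and l: "l \<in> {1..h}" for n l
  proof -
    have "n0 \<le> n - l + 1"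
      using n l by auto
    then obtain H :: "nat graph" where "H \<in> extremal_graphs (n - l + 1) (F l)"
        and free: "\<forall>j\<in>{1..l}. graph_free (F j) H"
      using n0 l by blast
    then have H: "simple_graph H" "card (verts H) = n - l + 1"
      "card (edges H) = ex_number (n - l + 1) (F l)"
      by (auto simp: extremal_graphs_def)
    let ?G = "graph_join (complete_graph (l - 1)) H"
    have "graph_free union_graph ?G"
      using simple l free
      by (intro disjoint_union_free_join[where J = "{1..l}"])
        (auto simp: card_verts_complete_graph simple_complete_graph)
    moreover have "card (verts ?G) = n"
      using card_verts_join[OF simple_complete_graph H(1)] H(2) l n
      by (simp add: card_verts_complete_graph)
    moreover have "card (edges ?G) = join_edges n l"
      using card_edges_join[OF simple_complete_graph H(1), of "l - 1"] H
      by (simp add: card_edges_complete_graph card_verts_complete_graph join_edges_def)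
    ultimately show ?thesis
      using simple_graph_join[OF simple_complete_graph H(1)] by blast
  qed
  then show ?thesis
    unfolding eventually_sequentially by blast
qed

lemma eventually_join_edges_le_ex_number:
  "\<forall>\<^sub>F n in sequentially. \<forall>l\<in>{1..h}. join_edges n l \<le> ex_number n union_graph"
  using eventually_join_edges_attained
  by eventually_elim (metis card_edges_le_ex_number simple_union_graph)

lemma card_edges_le_join_edges:
  fixes G :: "'a graph"
  assumes G: "simple_graph G" "h \<le> card (verts G)" and W: "W \<subseteq> verts G" "card W < h"
    and free: "graph_free (F (card W + 1)) (induced G (verts G - W))"
  defines "H \<equiv> induced G (verts G - W)" and "l \<equiv> card W + 1" and "n \<equiv> card (verts G)"
  shows "card (edges G) \<le> join_edges n l"
    and "card (edges G) = join_edges n l \<Longrightarrow>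
      H \<in> extremal_graphs (n - l + 1) (F l) \<and> graph_iso G (graph_join (complete_graph (l - 1)) H)"
proof -
  have H: "simple_graph H" "graph_free (F l) H"
    using G(1) free finite_verts[OF G(1)] by (auto simp: H_def l_def simple_graph_induced)
  have "finite W"
    using W(1) finite_verts[OF G(1)] by (rule finite_subset)
  then have cardH: "card (verts H) = n - l + 1"
    using W G(2) by (simp add: H_def induced_def card_Diff_subset l_def n_def)
  let ?J = "graph_join (complete_graph (l - 1)) H"
  have J: "simple_graph ?J"
    by (rule simple_graph_join[OF simple_complete_graph H(1)])
  have cardJ: "card (edges ?J) = ((l - 1) choose 2) + (l - 1) * (n - l + 1) + card (edges H)"
    using card_edges_join[OF simple_complete_graph H(1), of "l - 1"]
    by (simp add: card_edges_complete_graph card_verts_complete_graph cardH)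
  obtain f where f: "embedding f G ?J" "f ` verts G = verts ?J"
    using embedding_onto_join_complete[OF G(1) W(1)] unfolding H_def l_def by auto
  have edges_le_join: "card (edges G) \<le> card (edges ?J)"
    by (rule card_edges_le_if_embedding[OF G(1) J f(1)])
  have "simple_graph (F l)"
    using simple W(2) by (simp add: l_def)
  then have edges_H_le: "card (edges H) \<le> ex_number (n - l + 1) (F l)"
    using card_edges_le_ex_number[OF _ H] cardH by simp
  then show "card (edges G) \<le> join_edges n l"
    using edges_le_join cardJ by (simp add: join_edges_def)
  assume "card (edges G) = join_edges n l"
  then have "card (edges H) = ex_number (n - l + 1) (F l)" "card (edges G) = card (edges ?J)"
    using edges_le_join edges_H_le cardJ by (auto simp: join_edges_def)
  then show "H \<in> extremal_graphs (n - l + 1) (F l) \<and> graph_iso G ?J"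
    using H cardH graph_iso_if_embedding_onto[OF G(1) J f] by (simp add: extremal_graphs_def)
qed

lemma union_free_no_multipartite:
  assumes G: "simple_graph G" "graph_free union_graph G"
  shows "\<not> has_multipartite G (Suc r) total_verts (verts G)"
proof
  assume multipartite: "has_multipartite G (Suc r) total_verts (verts G)"
  have "\<exists>c. proper_colouring (F i) (Suc r) c" if "i \<in> {1..h}" for i
    using chromatic_number_colouring[OF simple[OF that]] chromatic[OF that] by auto
  then obtain c where "\<And>i. i \<in> {1..h} \<Longrightarrow> proper_colouring (F i) (Suc r) (c i)"
    by metis
  then have "proper_colouring union_graph (Suc r) (\<lambda>(i, x). c i x)"
    by (rule proper_colouring_disjoint_union)
  then have "\<exists>f. embedding f union_graph G"
    using card_verts_union_graph
    by (intro has_multipartite_embedding[OF simple_union_graph _ _ G(1) multipartite]) auto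
  then show False
    using G(2) graph_free_iff_no_embedding[OF simple_union_graph] by blast
qed

lemma eventually_competitive_near_extremal:
  fixes \<delta> :: real
  assumes "0 < \<delta>"
  shows "\<forall>\<^sub>F n in sequentially. \<forall>G :: 'a graph. competitive G \<longrightarrow> card (verts G) = n \<longrightarrow>
    near_extremal r total_verts \<delta> G (verts G)"
proof -
  have one: "1 \<in> {1..h}"
    using h by simp
  have "\<forall>\<^sub>F n in sequentially. (turan_density r - \<delta>) * (real n)\<^sup>2 / 2 \<le> ex_number n (F 1)"
    using eventually_ex_number_ge_density[OF simple[OF one] chromatic[OF one] _ assms] r by simp
  moreover have "\<forall>\<^sub>F n in sequentially. (1 :: nat) \<le> n"
    by (rule eventually_ge_at_top)
  ultimately show ?thesis
  proof (eventually_elim, intro allI impI)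
    fix n and G :: "'a graph"
    assume dense: "(turan_density r - \<delta>) * (real n)\<^sup>2 / 2 \<le> ex_number n (F 1)" and n: "1 \<le> n"
      and "competitive G" and card: "card (verts G) = n"
    then have G: "simple_graph G" "graph_free union_graph G" "join_edges n 1 \<le> card (edges G)"
      using one by (auto simp: competitive_def)
    then have "ex_number n (F 1) \<le> card (edges G)"
      using n by (simp add: join_edges_def)
    then have "edge_density_ge G (verts G) (turan_density r - \<delta>)"
      using dense card by (simp add: edge_density_ge_def edges_in_verts[OF G(1)])
    then show "near_extremal r total_verts \<delta> G (verts G)"
      using G(1) finite_verts[OF G(1)] union_free_no_multipartite[OF G(1,2)]
      by (simp add: near_extremal_def)
  qed
qed

lemma eventually_high_degree_robust_host:
  "\<forall>\<^sub>F n in sequentially. \<forall>G :: 'a graph. competitive G \<longrightarrow> card (verts G) = n \<longrightarrow>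
    (\<forall>w\<in>high_degree_verts G. \<forall>i\<in>{1..h}. robust_host (h + total_verts) (F i) G w)"
proof -
  have "eps \<le> 1"
    using eps_bounds(2) by simp
  from near_extremal_high_degree_nbrs[OF r eps_bounds(1) this]
  obtain \<delta> where "0 < \<delta>" and nbrs: "\<forall>\<^sub>F n in sequentially. \<forall>(G :: 'a graph) V v Z.
      near_extremal r total_verts \<delta> G V \<longrightarrow> card V = n \<longrightarrow>
      (turan_density r + eps) * card V \<le> degree_in G V v \<longrightarrow>
      finite Z \<longrightarrow> card Z \<le> h + total_verts \<longrightarrow> has_multipartite G r total_verts (nbrs G v \<inter> V - Z)" .
  from nbrs eventually_competitive_near_extremal[OF \<open>0 < \<delta>\<close>, where 'a = 'a] show ?thesis
  proof (eventually_elim, intro allI impI ballI)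
    fix n and G :: "'a graph" and w i
    assume nbrs: "\<forall>(G :: 'a graph) V v Z.
        near_extremal r total_verts \<delta> G V \<longrightarrow> card V = n \<longrightarrow>
        (turan_density r + eps) * card V \<le> degree_in G V v \<longrightarrow>
        finite Z \<longrightarrow> card Z \<le> h + total_verts \<longrightarrow> has_multipartite G r total_verts (nbrs G v \<inter> V - Z)"
      and near: "\<forall>G :: 'a graph. competitive G \<longrightarrow> card (verts G) = n \<longrightarrow>
        near_extremal r total_verts \<delta> G (verts G)"
      and G: "competitive G" "card (verts G) = n" and w: "w \<in> high_degree_verts G"
      and i: "i \<in> {1..h}"
    have nbrs_w: "has_multipartite G r total_verts (nbrs G w \<inter> verts G - Z)"
      if "finite Z" "card Z \<le> h + total_verts" for Z
      using nbrs near G w that by (simp add: high_degree_verts_def)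
    have G': "simple_graph G" "w \<in> verts G"
      using G(1) w by (auto simp: competitive_def high_degree_verts_def)
    note critical_F = simple[OF i] critical[OF i] chromatic[OF i] card_verts_le_total_verts[OF i]
    show "robust_host (h + total_verts) (F i) G w"
      unfolding robust_host_def
      by (intro allI impI vertex_critical_embedding[OF critical_F G'] nbrs_w)
  qed
qed

lemma card_packing_less:
  fixes G :: "'a graph"
  assumes free: "graph_free union_graph G" and W: "finite W"
    and host: "\<And>w i. w \<in> W \<Longrightarrow> i \<in> {1..h} \<Longrightarrow> robust_host (h + total_verts) (F i) G w"
    and I: "I \<subseteq> {1..h}"
    and f: "embedding f (disjoint_union I F) G" "W \<inter> f ` verts (disjoint_union I F) = {}"
  shows "card I + card W < h"
proof (rule ccontr)
  assume "\<not> ?thesis"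
  moreover have "card I \<le> h" "finite I"
    using card_mono[OF _ I] finite_subset[OF I] by auto
  ultimately have "h - card I \<le> card W"
    by simp
  then obtain W' where W': "W' \<subseteq> W" "card W' = h - card I"
    by (meson obtain_subset_with_card_n)
  have "\<exists>f. embedding f (disjoint_union (I \<union> ({1..h} - I)) F) G"
  proof (rule packing_extend_by_robust_hosts[OF _ \<open>finite I\<close> _ _ _ _ f(1)])
    show "card W' = card ({1..h} - I)"
      using W'(2) I \<open>finite I\<close> by (simp add: card_Diff_subset)
    show "robust_host (h + total_verts) (F i) G w" if "w \<in> W'" "i \<in> {1..h} - I" for w i
      using host that W'(1) by blast
    show "card W' + (\<Sum>i\<in>I \<union> ({1..h} - I). card (verts (F i))) \<le> h + total_verts"
      using W'(2) I by (simp add: total_verts_def Un_absorb1)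
  qed (use W W' f(2) simple I finite_subset in auto)
  then show False
    using I free graph_free_iff_no_embedding[OF simple_union_graph] by (metis Diff_partition)
qed

lemma exists_late_unused_index:
  assumes I: "I \<subseteq> {1..h}" "s + 1 \<in> I" and card: "card I + s < h"
  shows "\<exists>j\<in>{1..h} - I. s + 2 \<le> j"
proof (rule ccontr)
  assume none: "\<not> ?thesis"
  have "{1..h} \<subseteq> I \<union> {1..s}"
  proof
    fix j
    assume j: "j \<in> {1..h}"
    show "j \<in> I \<union> {1..s}"
    proof (cases "j \<in> I")
      case False
      then have "j \<noteq> s + 1" "\<not> s + 2 \<le> j"
        using none I(2) j by blast+
      then show ?thesis
        using j by auto
    qed simp
  qed
  then have "h \<le> card (I \<union> {1..s})"
    using card_mono[of "I \<union> {1..s}" "{1..h}"] finite_subset[OF I(1)] by simp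
  then show False
    using card_Un_le[of I "{1..s}"] card by simp
qed

lemma eventually_has_edge_surplus: "\<forall>\<^sub>F N in sequentially. has_edge_surplus N"
proof -
  have "eps \<le> turan_density r"
    using turan_density_ge_half[OF r] eps_bounds(2) by linarith
  then have "\<forall>\<^sub>F N in sequentially. \<forall>j\<in>{1..h}. \<forall>k.
      ex_number N (F j) + k * ((turan_density r - eps) * N) \<le> ex_number (N + k) (F j)"
    using eventually_ex_number_growth_iterated[OF simple critical chromatic r eps_bounds(1)]
    by (intro eventually_ball_finite) auto
  moreover have "\<forall>\<^sub>F N in sequentially. \<forall>m\<ge>N. \<forall>l\<in>{1..h}. \<forall>j\<in>{1..l}. ex_number m (F l) \<le>
    ex_number m (F j)"
    using eventually_ex_number_antimono by (rule eventually_all_ge_at_top)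
  moreover have "\<forall>\<^sub>F N in sequentially.
      2 * real r * ((real h + 2 * real total_verts) * (real h + real total_verts)) < 1 * real N"
    by (rule eventually_less_mult_of_nat) simp
  ultimately show ?thesis
    unfolding has_edge_surplus_def
  proof (eventually_elim, intro allI ballI impI)
    fix N s k j
    assume growth: "\<forall>j\<in>{1..h}. \<forall>k. ex_number N (F j) + k * ((turan_density r - eps) * N) \<le>
      ex_number (N + k) (F j)"
      and antimono: "\<forall>m\<ge>N. \<forall>l\<in>{1..h}. \<forall>j\<in>{1..l}. ex_number m (F l) \<le> ex_number m (F j)"
      and N: "2 * real r * ((real h + 2 * real total_verts) * (real h + real total_verts)) <
        1 * real N"
      and j: "j \<in> {s + 2..h}" and k: "k < total_verts"
    have "ex_number N (F j) + k * ((turan_density r - eps) * N) \<le> ex_number (N + k) (F j)"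
      using growth j by simp
    also have "ex_number (N + k) (F j) \<le> ex_number (N + k) (F (s + 2))"
      using antimono j by simp
    finally have "ex_number N (F j) + k * ((turan_density r - eps) * N) \<le>
      ex_number (N + k) (F (s + 2))"
      by simp
    moreover have "real s * (real N + s + k + 1)
      + (real k + 1) * ((1 - 1 / real r + eps) * (real N + s + k + 1)) <
        (real s + 1) * (real N + k) + k * ((1 - 1 / real r - eps) * N)"
      using j k r N eps_bounds by (intro edge_surplus[of _ "real h" _ "real total_verts"]) auto
    ultimately show "real s * (real N + s + k + 1)
      + (real k + 1) * ((turan_density r + eps) * (real N + s + k + 1)) + ex_number N (F j) <
        (real s + 1) * (real N + k) + ex_number (N + k) (F (s + 2))"
      by (simp add: turan_density_def)
  qed
qed

lemma competitive_deletion_not_free: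
  fixes G :: "'a graph"
  assumes comp: "competitive G"
    and X: "X \<subseteq> verts G - high_degree_verts G" "X \<noteq> {}" "card X \<le> total_verts"
    and j: "j \<in> {card (high_degree_verts G) + 2..h}" and large: "h + total_verts < card (verts G)"
    and surplus: "has_edge_surplus (card (verts G) - card (high_degree_verts G) - card X)"
  shows "\<not> graph_free (F j) (induced G (verts G - high_degree_verts G - X))"
proof
  define W where "W = high_degree_verts G"
  define s where "s = card W"
  define N where "N = card (verts G) - s - card X"
  assume free: "graph_free (F j) (induced G (verts G - high_degree_verts G - X))"
  have G: "simple_graph G"
    using comp by (simp add: competitive_def)
  have W: "W \<subseteq> verts G"
    by (auto simp: W_def high_degree_verts_def)
  have "finite X"
    using X(1) finite_verts[OF G] finite_subset by blast
  then obtain k where k: "card X = Suc k"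
    using X(2) by (metis card_eq_0_iff not0_implies_Suc)
  have N: "0 < N" "card (verts G) = N + s + k + 1"
    using large X(3) j by (auto simp: N_def s_def W_def k)
  have "simple_graph (F j)"
    using simple j by simp
  then have "card (edges G) \<le> card W * real (card (verts G)) +
      card X * ((turan_density r + eps) * card (verts G)) +
        ex_number (card (verts G) - card W - card X) (F j)"
    using X(1) free
    by (intro card_edges_le_after_deletion[OF _ G W]) (auto simp: W_def high_degree_verts_def)
  then have upper: "card (edges G) \<le> real s * (real N + s + k + 1) +
      (real k + 1) * ((turan_density r + eps) * (real N + s + k + 1)) + ex_number N (F j)"
    unfolding s_def[symmetric] N_def[symmetric] N(2) k by (simp add: add_ac)
  have "s + 2 \<in> {1..h}"
    using j by (simp add: s_def W_def)
  then have "join_edges (card (verts G)) (s + 2) \<le> card (edges G)"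
    using comp by (simp add: competitive_def)
  then have "(s + 1) * (N + k) + ex_number (N + k) (F (s + 2)) \<le> card (edges G)"
    using N by (simp add: join_edges_def Suc_diff_Suc)
  then have "real ((s + 1) * (N + k) + ex_number (N + k) (F (s + 2))) \<le> card (edges G)"
    by (rule of_nat_mono)
  moreover have "real s * (real N + s + k + 1) +
      (real k + 1) * ((turan_density r + eps) * (real N + s + k + 1)) + ex_number N (F j) <
      (real s + 1) * (real N + k) + ex_number (N + k) (F (s + 2))"
    using surplus j X(3) k unfolding has_edge_surplus_def N_def s_def W_def by force
  ultimately show False
    using upper by (simp add: algebra_simps)
qed

lemma exists_deletion_free:
  fixes G :: "'a graph"
  assumes G: "graph_free union_graph G" and W: "finite W" "card W < h"
    and host: "\<forall>w\<in>W. \<forall>i\<in>{1..h}. robust_host (h + total_verts) (F i) G w"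
    and not_free: "\<not> graph_free (F (card W + 1)) (induced G (verts G - W))"
  shows "\<exists>X j. X \<subseteq> verts G - W \<and> X \<noteq> {} \<and> card X \<le> total_verts \<and> j \<in> {card W + 2..h} \<and>
    graph_free (F j) (induced G (verts G - W - X))"
proof -
  have next_index: "card W + 1 \<in> {1..h}"
    using W(2) by simp
  then obtain g where g: "embedding g (F (card W + 1)) G" "g ` verts (F (card W + 1)) \<subseteq> verts G - W"
    using not_free graph_free_induced_iff[OF simple Diff_subset] by blast
  obtain I f where I: "card W + 1 \<in> I" "I \<subseteq> {1..h}"
      and f: "embedding f (disjoint_union I F) G" "f ` verts (disjoint_union I F) \<subseteq> verts G - W"
      and maximal: "\<forall>j\<in>{1..h} - I. \<nexists>g. embedding g (F j) G \<and>
        g ` verts (F j) \<subseteq> verts G - W - f ` verts (disjoint_union I F)"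
    using exists_maximal_packing[where F = F, OF finite_atLeastAtMost next_index g] by blast
  define X where "X = f ` verts (disjoint_union I F)"
  have "card I + card W < h"
    using host f(2) by (intro card_packing_less[OF G W(1) _ I(2) f(1)]) auto
  then obtain j where j: "j \<in> {1..h}" "j \<notin> I" "card W + 2 \<le> j"
    using exists_late_unused_index[OF I(2,1)] by blast
  have "verts G - W - X \<subseteq> verts G"
    by blast
  then have "graph_free (F j) (induced G (verts G - W - X))"
    using maximal j(1,2) graph_free_induced_iff[OF simple[OF j(1)]] unfolding X_def by blast
  moreover have "X \<noteq> {}"
    using I(1) verts_nonempty[OF next_index] by (auto simp: X_def disjoint_union_def)
  moreover have "card X \<le> total_verts"
  proof -
    have "verts (disjoint_union I F) \<subseteq> verts union_graph"
      using I(2) by (auto simp: disjoint_union_def)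
    then have "card (verts (disjoint_union I F)) \<le> total_verts"
      "finite (verts (disjoint_union I F))"
      using finite_verts[OF simple_union_graph] card_verts_union_graph
      by (metis card_mono, metis finite_subset)
    then show ?thesis
      unfolding X_def using card_image_le le_trans by blast
  qed
  ultimately show ?thesis
    using f(2) j by (intro exI[of _ X] exI[of _ j]) (simp add: X_def)
qed

lemma competitive_structure:
  fixes G :: "'a graph"
  assumes comp: "competitive G" and large: "h + total_verts < card (verts G)"
    and host: "\<forall>w\<in>high_degree_verts G. \<forall>i\<in>{1..h}. robust_host (h + total_verts) (F i) G w"
    and surplus: "\<And>N. card (verts G) \<le> N + h + total_verts \<Longrightarrow> has_edge_surplus N"
  shows "\<exists>W\<subseteq>verts G. card W < h \<and> graph_free (F (card W + 1)) (induced G (verts G - W))"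
proof -
  define W where "W = high_degree_verts G"
  have G: "simple_graph G" "graph_free union_graph G"
    using comp by (auto simp: competitive_def)
  have W: "W \<subseteq> verts G" "finite W"
    using finite_verts[OF G(1)] by (auto simp: W_def high_degree_verts_def)
  have "embedding undefined (disjoint_union {} F) G"
    by (simp add: embedding_def disjoint_union_def)
  then have "card W < h"
    using card_packing_less[OF G(2) W(2), of "{}" undefined] host
    by (simp add: W_def disjoint_union_def)
  moreover have "graph_free (F (card W + 1)) (induced G (verts G - W))"
  proof (rule ccontr)
    assume "\<not> ?thesis"
    then obtain X j where X: "X \<subseteq> verts G - W" "X \<noteq> {}" "card X \<le> total_verts"
      and j: "j \<in> {card W + 2..h}"
      and "graph_free (F j) (induced G (verts G - W - X))"
      using exists_deletion_free[OF G(2) W(2) \<open>card W < h\<close>] host unfolding W_def by blast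
    moreover have "has_edge_surplus (card (verts G) - card W - card X)"
      using \<open>card W < h\<close> X(3) by (intro surplus) simp
    ultimately show False
      using competitive_deletion_not_free[OF comp, of X j] large unfolding W_def by blast
  qed
  ultimately show ?thesis
    using W(1) by blast
qed

lemma eventually_competitive_structure:
  "\<forall>\<^sub>F n in sequentially. \<forall>G :: 'a graph. competitive G \<longrightarrow> card (verts G) = n \<longrightarrow>
    (\<exists>W\<subseteq>verts G. card W < h \<and> graph_free (F (card W + 1)) (induced G (verts G - W)))"
proof -
  obtain N0 where N0: "\<And>N. N0 \<le> N \<Longrightarrow> has_edge_surplus N"
    using eventually_has_edge_surplus unfolding eventually_sequentially by blast
  have "\<forall>\<^sub>F n in sequentially. N0 + h + total_verts < n"
    by (rule eventually_gt_at_top)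
  with eventually_high_degree_robust_host[where 'a = 'a] show ?thesis
  proof (eventually_elim, intro allI impI)
    fix n and G :: "'a graph"
    assume host: "\<forall>G :: 'a graph. competitive G \<longrightarrow> card (verts G) = n \<longrightarrow>
        (\<forall>w\<in>high_degree_verts G. \<forall>i\<in>{1..h}. robust_host (h + total_verts) (F i) G w)"
      and n: "N0 + h + total_verts < n" and G: "competitive G" "card (verts G) = n"
    have "has_edge_surplus N" if "card (verts G) \<le> N + h + total_verts" for N
      using that n G(2) by (intro N0) simp
    then show "\<exists>W\<subseteq>verts G. card W < h \<and> graph_free (F (card W + 1)) (induced G (verts G - W))"
      using n host G by (intro competitive_structure) auto
  qed
qed

lemma eventually_competitive_upper_bound:
  "\<forall>\<^sub>F n in sequentially. \<forall>G :: 'a graph. competitive G \<longrightarrow> card (verts G) = n \<longrightarrow>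
    (\<exists>l\<in>{1..h}. card (edges G) \<le> join_edges n l \<and> (card (edges G) = join_edges n l \<longrightarrow>
      (\<exists>H :: 'a graph. H \<in> extremal_graphs (n - l + 1) (F l) \<and>
        graph_iso G (graph_join (complete_graph (l - 1)) H))))"
  using eventually_competitive_structure[where 'a = 'a] eventually_ge_at_top[of h]
proof (eventually_elim, intro allI impI)
  fix n and G :: "'a graph"
  assume deletion: "\<forall>G :: 'a graph. competitive G \<longrightarrow> card (verts G) = n \<longrightarrow>
      (\<exists>W\<subseteq>verts G. card W < h \<and> graph_free (F (card W + 1)) (induced G (verts G - W)))"
    and n: "h \<le> n" and G: "competitive G" "card (verts G) = n"
  obtain W where W: "W \<subseteq> verts G" "card W < h"
    "graph_free (F (card W + 1)) (induced G (verts G - W))"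
    using deletion G by blast
  have "simple_graph G" "h \<le> card (verts G)"
    using G n by (auto simp: competitive_def)
  note bound = card_edges_le_join_edges[OF this W, unfolded G(2)]
  show "\<exists>l\<in>{1..h}. card (edges G) \<le> join_edges n l \<and> (card (edges G) = join_edges n l \<longrightarrow>
      (\<exists>H :: 'a graph. H \<in> extremal_graphs (n - l + 1) (F l) \<and>
        graph_iso G (graph_join (complete_graph (l - 1)) H)))"
    using bound W(2) by (intro bexI[of _ "card W + 1"]) auto
qed

lemma extremal_graph_competitive:
  assumes "\<forall>l\<in>{1..h}. join_edges n l \<le> ex_number n union_graph" "G \<in> extremal_graphs n union_graph"
  shows "competitive G" "card (verts G) = n" "card (edges G) = ex_number n union_graph"
  using assms by (auto simp: extremal_graphs_def competitive_def)

theorem eventually_ex_number_union: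
  "\<forall>\<^sub>F n in sequentially. ex_number n union_graph = (MAX l\<in>{1..h}. join_edges n l)"
  using eventually_competitive_upper_bound[where 'a = nat] eventually_join_edges_attained
    eventually_join_edges_le_ex_number
proof eventually_elim
  case (elim n)
  have "1 \<in> {1..h}"
    using h by simp
  then obtain G :: "nat graph" where G: "G \<in> extremal_graphs n union_graph"
    using elim(2) extremal_graphs_nonempty[OF simple_union_graph] by metis
  obtain l where "l \<in> {1..h}" "ex_number n union_graph \<le> join_edges n l"
    using elim(1) extremal_graph_competitive[OF elim(3) G] by metis
  then have "ex_number n union_graph \<in> join_edges n ` {1..h}"
    using elim(3) by (intro image_eqI[of _ _ l]) (auto intro: antisym)
  then show ?case
    using elim(3) by (intro Max_eqI[symmetric]) auto
qed

theorem eventually_extremal_graphs_union: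
  "\<forall>\<^sub>F n in sequentially. \<forall>G :: 'a graph. G \<in> extremal_graphs n union_graph \<longrightarrow>
    (\<exists>l\<in>{1..h}. \<exists>H :: 'a graph. H \<in> extremal_graphs (n - l + 1) (F l) \<and>
      graph_iso G (graph_join (complete_graph (l - 1)) H))"
  using eventually_competitive_upper_bound[where 'a = 'a] eventually_join_edges_le_ex_number
proof eventually_elim
  case (elim n)
  show ?case
  proof (intro allI impI)
    fix G :: "'a graph"
    assume "G \<in> extremal_graphs n union_graph"
    note G = extremal_graph_competitive[OF elim(2) this]
    obtain l where l: "l \<in> {1..h}" "card (edges G) \<le> join_edges n l"
        "card (edges G) = join_edges n l \<longrightarrow> (\<exists>H :: 'a graph. H \<in> extremal_graphs (n - l + 1) (F l) \<and>
          graph_iso G (graph_join (complete_graph (l - 1)) H))"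
      using elim(1) G(1,2) by blast
    moreover have "join_edges n l \<le> card (edges G)"
      using elim(2) l(1) G(3) by simp
    ultimately show "\<exists>l\<in>{1..h}. \<exists>H :: 'a graph. H \<in> extremal_graphs (n - l + 1) (F l) \<and>
        graph_iso G (graph_join (complete_graph (l - 1)) H)"
      by auto
  qed
qed

end

theorem theorem3:
  fixes F :: "nat \<Rightarrow> 'f graph" and h r :: nat
  assumes "h \<ge> 2" and "r \<ge> 2"
    and "\<And>i. i \<in> {1..h} \<Longrightarrow> simple_graph (F i)"
    and "\<And>i. i \<in> {1..h} \<Longrightarrow> vertex_critical (F i)"
    and "\<And>i. i \<in> {1..h} \<Longrightarrow> chromatic_number (F i) = r + 1"
    and "properly_ordered h F"
  shows "\<forall>\<^sub>F n in sequentially.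
           ex_number n (disjoint_union {1..h} F) =
             (MAX l\<in>{1..h}.
                ((l - 1) choose 2) + (l - 1) * (n - l + 1) + ex_number (n - l + 1) (F l)) \<and>
           (\<forall>G :: 'a graph. G \<in> extremal_graphs n (disjoint_union {1..h} F) \<longrightarrow>
              (\<exists>l\<in>{1..h}. \<exists>H :: 'a graph.
                 H \<in> extremal_graphs (n - l + 1) (F l) \<and>
                 graph_iso G (graph_join (complete_graph (l - 1)) H)))"
proof -
  interpret properly_ordered_critical_family F h r
    using assms by unfold_locales auto
  show ?thesis
    using eventually_ex_number_union eventually_extremal_graphs_union
    unfolding join_edges_def by (rule eventually_conj)
qed

end
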